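(* Let $n>0$ and let $P=\{f_1,\ldots,f_n\}$ be a family of continuous functions $[0,1]\to[0,1]$. Let $\mathbb{A}$ be the set of formulas in variables $X_1,\ldots,X_n$ consisting of $\rho=X_1\oplus\cdots\oplus X_n$, the formulas $\alpha_{ij}=\neg(X_i\odot X_j)$ for $i,j\in\{1,\ldots,n\}$ with $|i-j|=1$, and the formulas $\beta_{ij}=\neg(X_i\wedge X_j)$ for $i,j\in\{1,\ldots,n\}$ with $|i-j|>1$. The following are equivalent: (i) $P$ is a pseudo-triangular basis; (ii) $P$ is separating and $\Theta_P=\mathbb{A}^{\vdash}$, where $\mathbb{A}^{\vdash}$ is the set of formulas in $X_1,\ldots,X_n$ provable in {\L}ukasiewicz logic from the assumptions $\mathbb{A}$.
   Context: Formulas over $X_1,\ldots,X_n$ are built from the variables, the constant $\bot$, the unary connective $\neg$ and the binary connective $\to$, with derived connectives $\alpha\oplus\beta:=\neg\alpha\to\beta$, $\alpha\odot\beta:=\neg(\alpha\to\neg\beta)$, $\alpha\vee\beta:=(\alpha\to\beta)\to\beta$, $\alpha\wedge\beta:=\neg(\neg\alpha\vee\neg\beta)$. An evaluation is a map $\mu$ from formulas to $[0,1]$ with $\mu(\bot)=0$, $\mu(\neg\alpha)=1-\mu(\alpha)$, $\mu(\alpha\to\beta)=\min\{1,1-\mu(\alpha)+\mu(\beta)\}$ (so $\mu(\alpha\oplus\beta)=\min\{1,\mu(\alpha)+\mu(\beta)\}$, $\mu(\alpha\odot\beta)=\max\{0,\mu(\alpha)+\mu(\beta)-1\}$, $\mu(\alpha\wedge\beta)=\min\{\mu(\alpha),\mu(\beta)\}$).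 Provability from a set of assumptions $S$ in {\L}ukasiewicz logic uses $S$ together with all instances of the axiom schemata $\bot\to\alpha$; $\alpha\to(\beta\to\alpha)$; $(\alpha\to\beta)\to((\beta\to\gamma)\to(\alpha\to\gamma))$; $((\alpha\to\beta)\to\beta)\to((\beta\to\alpha)\to\alpha)$; $(\neg\alpha\to\neg\beta)\to(\beta\to\alpha)$, with modus ponens as the only rule. $\Theta_P$ is the set of formulas $\varphi$ in $X_1,\ldots,X_n$ such that $\mu(\varphi)=1$ for every evaluation $\mu$ for which there is $x\in[0,1]$ with $\mu(X_i)=f_i(x)$ for all $i$. $P$ is separating if for all $x\neq y$ in $[0,1]$, $(f_1(x),\ldots,f_n(x))\neq(f_1(y),\ldots,f_n(y))$. $P$ is a pseudo-triangular basis if there exist reals $0=t_1<t_2<\cdots<t_n=1$ such that, after a suitable permutation of the indices of the $f_i$, for each $i=1,\ldots,n-1$: (a) $f_i(t_i)=1$ and $f_i(t_{i+1})=0$; (b) $f_j(x)=0$ for all $x\in[t_i,t_{i+1}]$ and all $j\neq i,i+1$; (c) $f_{i+1}(x)=1-f_i(x)$ for $x\in[t_i,t_{i+1}]$; (d) $f_i$ and $f_{i+1}$ restricted to $[t_i,t_{i+1}]$ are bijections onto $[0,1]$.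
   Formalization: In (ii), Θ_P = A^⊢ is required only after some permutation of the indices of the f_i, since (i)⇒(ii) fails literally (n=3, hats in the order f_1,f_3,f_2); it is also stated that Θ_P = A^⊢ holds as written whenever (a)–(d) hold in the given numbering. *)

theory Defs
  imports "HOL-Analysis.Analysis" "HOL-Combinatorics.Permutations"
begin

datatype fm = Var nat | Bot | Neg fm | Imp fm fm

primrec vars :: "fm \<Rightarrow> nat set" where
  "vars (Var i) = {i}"
| "vars Bot = {}"
| "vars (Neg a) = vars a"
| "vars (Imp a b) = vars a \<union> vars b"

definition formulas :: "nat \<Rightarrow> fm set" where
  "formulas n = {a. vars a \<subseteq> {1..n}}"

definition Oplus :: "fm \<Rightarrow> fm \<Rightarrow> fm" where
  "Oplus a b = Imp (Neg a) b"

definition Odot :: "fm \<Rightarrow> fm \<Rightarrow> fm" where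
  "Odot a b = Neg (Imp a (Neg b))"

definition Vee :: "fm \<Rightarrow> fm \<Rightarrow> fm" where
  "Vee a b = Imp (Imp a b) b"

definition Wedge :: "fm \<Rightarrow> fm \<Rightarrow> fm" where
  "Wedge a b = Neg (Vee (Neg a) (Neg b))"

definition evaluation :: "(fm \<Rightarrow> real) \<Rightarrow> bool" where
  "evaluation \<mu> \<longleftrightarrow>
     (\<forall>a. \<mu> a \<in> {0..1}) \<and>
     \<mu> Bot = 0 \<and>
     (\<forall>a. \<mu> (Neg a) = 1 - \<mu> a) \<and>
     (\<forall>a b. \<mu> (Imp a b) = min 1 (1 - \<mu> a + \<mu> b))"

inductive provable :: "fm set \<Rightarrow> fm \<Rightarrow> bool" for S :: "fm set" where
  assumption: "a \<in> S \<Longrightarrow> provable S a"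
| ax_bot: "provable S (Imp Bot a)"
| ax_weak: "provable S (Imp a (Imp b a))"
| ax_trans: "provable S (Imp (Imp a b) (Imp (Imp b c) (Imp a c)))"
| ax_luk: "provable S (Imp (Imp (Imp a b) b) (Imp (Imp b a) a))"
| ax_contra: "provable S (Imp (Imp (Neg a) (Neg b)) (Imp b a))"
| mp: "provable S a \<Longrightarrow> provable S (Imp a b) \<Longrightarrow> provable S b"

definition consequences :: "nat \<Rightarrow> fm set \<Rightarrow> fm set" where
  "consequences n S = {a \<in> formulas n. provable S a}"

text \<open>Families \<open>f\<^sub>1, \<dots>, f\<^sub>n\<close> of functions on the unit interval are given by
  \<open>f :: nat \<Rightarrow> real \<Rightarrow> real\<close>; only indices in \<open>{1..n}\<close> and arguments in \<open>{0..1}\<close> matter.\<close>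

definition Theta :: "nat \<Rightarrow> (nat \<Rightarrow> real \<Rightarrow> real) \<Rightarrow> fm set" where
  "Theta n f = {a \<in> formulas n.
     \<forall>\<mu>. evaluation \<mu> \<longrightarrow> (\<exists>x\<in>{0..1}. \<forall>i\<in>{1..n}. \<mu> (Var i) = f i x) \<longrightarrow> \<mu> a = 1}"

definition separating :: "nat \<Rightarrow> (nat \<Rightarrow> real \<Rightarrow> real) \<Rightarrow> bool" where
  "separating n f \<longleftrightarrow>
     (\<forall>x\<in>{0..1}. \<forall>y\<in>{0..1}. x \<noteq> y \<longrightarrow> (\<exists>i\<in>{1..n}. f i x \<noteq> f i y))"

text \<open>Conditions (a)--(d) for the given numbering of the functions. For \<open>n = 1\<close> no
  nodes exist, since \<open>t 1\<close> would have to be both 0 and 1.\<close>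

definition ordered_pseudo_triangular_basis ::
    "nat \<Rightarrow> (nat \<Rightarrow> real \<Rightarrow> real) \<Rightarrow> bool" where
  "ordered_pseudo_triangular_basis n f \<longleftrightarrow>
     (\<exists>t :: nat \<Rightarrow> real. t 1 = 0 \<and> t n = 1 \<and> (\<forall>i\<in>{1..<n}. t i < t (i + 1)) \<and>
       (\<forall>i\<in>{1..<n}.
          f i (t i) = 1 \<and> f i (t (i + 1)) = 0 \<and>
          (\<forall>j\<in>{1..n}. j \<noteq> i \<longrightarrow> j \<noteq> i + 1 \<longrightarrow> (\<forall>x\<in>{t i..t (i + 1)}. f j x = 0)) \<and>
          (\<forall>x\<in>{t i..t (i + 1)}. f (i + 1) x = 1 - f i x) \<and>
          bij_betw (f i) {t i..t (i + 1)} {0..1} \<and>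
          bij_betw (f (i + 1)) {t i..t (i + 1)} {0..1}))"

text \<open>Invariant under renumbering the functions, whereas \<open>Theta n f\<close> is not: it can
  be compared with the axioms \<open>AA n\<close> below only after a suitable renumbering \<open>f \<circ> \<sigma>\<close>.\<close>

definition pseudo_triangular_basis :: "nat \<Rightarrow> (nat \<Rightarrow> real \<Rightarrow> real) \<Rightarrow> bool" where
  "pseudo_triangular_basis n f \<longleftrightarrow>
     (\<exists>\<sigma>. \<sigma> permutes {1..n} \<and> ordered_pseudo_triangular_basis n (f \<circ> \<sigma>))"

text \<open>The sum is bracketed to the left.\<close>

definition rho :: "nat \<Rightarrow> fm" where
  "rho n = foldl Oplus (Var 1) (map Var [2..<Suc n])"

definition AA :: "nat \<Rightarrow> fm set" where
  "AA n = {rho n}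
     \<union> {Neg (Odot (Var i) (Var j)) | i j.
          i \<in> {1..n} \<and> j \<in> {1..n} \<and> \<bar>int i - int j\<bar> = 1}
     \<union> {Neg (Wedge (Var i) (Var j)) | i j.
          i \<in> {1..n} \<and> j \<in> {1..n} \<and> \<bar>int i - int j\<bar> > 1}"

end

theory Submission imports Defs begin

text \<open>The models of \<open>AA n\<close> in \<open>[0,1]\<^sup>n\<close> form the piecewise linear path
  \<open>e\<^sub>1, \<dots>, e\<^sub>n\<close>.  A pseudo-triangular basis parametrises this path, so the implication from
  (i) to (ii) amounts to a strong completeness theorem for \<open>AA n\<close>.  To refute an underivable
  formula, extend \<open>AA n\<close> to a theory \<open>T\<close> that orders all formulas linearly and still does not
  derive it.  In \<open>T\<close> all variables but two neighbours \<open>p = X\<^sub>i, q = X\<^sub>i\<^sub>+\<^sub>1\<close> vanish, and \<open>p + q = 1\<close>.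
  A Euclidean algorithm (Farey subdivision) repeatedly replaces the larger of \<open>p, q\<close> by their
  difference, keeping a relation \<open>m p + n q = 1\<close>, until the formula becomes \<open>i p + j q\<close> with
  natural coefficients.  As it is not \<open>1\<close>, \<open>i < m\<close> or \<open>j < n\<close>, so it is refuted on the
  corresponding real interval at \<open>p = 1/m, q = 0\<close> or at \<open>p = 0, q = 1/n\<close>.

  Conversely, (ii) forces the image of the family into the path and onto all its vertices, so the
  position on the path is a continuous injective function on \<open>[0,1]\<close>, hence strictly
  monotone; if it decreases, the numbering is reversed.\<close>

section \<open>Derivability in Lukasiewicz logic\<close>

locale derivability =
  fixes S :: "fm set"
begin

definition le (infix "\<preceq>" 50) where
  "a \<preceq> b \<longleftrightarrow> provable S (Imp a b)"

definition eqv (infix "\<simeq>" 50) where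
  "a \<simeq> b \<longleftrightarrow> a \<preceq> b \<and> b \<preceq> a"

lemma eqvD1: "a \<simeq> b \<Longrightarrow> a \<preceq> b" and eqvD2: "a \<simeq> b \<Longrightarrow> b \<preceq> a"
  by (auto simp: eqv_def)

lemma le_mp: "provable S a \<Longrightarrow> a \<preceq> b \<Longrightarrow> provable S b"
  unfolding le_def by (rule mp)

lemmas Bot_le = ax_bot [of S, folded le_def]
lemmas le_weak = ax_weak [of S, folded le_def]
lemmas Imp_le_trans = ax_trans [of S, folded le_def]
lemmas le_luk = ax_luk [of S, folded le_def]
lemmas le_contra = ax_contra [of S, folded le_def]

lemma le_mp_Imp: "provable S t \<Longrightarrow> t \<preceq> Imp a b \<Longrightarrow> a \<preceq> b"
  unfolding le_def by (rule mp)

lemma Imp_le_ImpD: "Imp a b \<preceq> Imp c d \<Longrightarrow> a \<preceq> b \<Longrightarrow> c \<preceq> d"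
  unfolding le_def by (rule mp)

lemma le_trans [trans]: "a \<preceq> b \<Longrightarrow> b \<preceq> c \<Longrightarrow> a \<preceq> c"
  using Imp_le_trans Imp_le_ImpD by blast

lemma eqv_le_trans [trans]: "a \<simeq> b \<Longrightarrow> b \<preceq> c \<Longrightarrow> a \<preceq> c"
  using le_trans eqvD1 by blast

lemma le_eqv_trans [trans]: "a \<preceq> b \<Longrightarrow> b \<simeq> c \<Longrightarrow> a \<preceq> c"
  using le_trans eqvD1 by blast

lemma eqv_trans [trans]: "a \<simeq> b \<Longrightarrow> b \<simeq> c \<Longrightarrow> a \<simeq> c"
  unfolding eqv_def using le_trans by blast

lemma eqv_sym: "a \<simeq> b \<Longrightarrow> b \<simeq> a"
  by (auto simp: eqv_def)

lemma provable_le: "provable S b \<Longrightarrow> a \<preceq> b"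
  using le_weak le_mp_Imp by blast

text \<open>The Lukasiewicz axiom turns \<open>Imp (Imp x t) t\<close>, which follows from
  \<open>t\<close> by weakening, into the claim.\<close>

lemma Imp_theorem_le:
  assumes "provable S t"
  shows "Imp t x \<preceq> x"
  using provable_le [OF assms] assms le_luk Imp_le_ImpD le_mp_Imp le_weak by blast

lemma le_refl: "a \<preceq> a"
  using le_trans [OF le_weak Imp_theorem_le] ax_bot by blast

lemma eqv_refl: "a \<simeq> a"
  by (simp add: eqv_def le_refl)

lemma le_Imp_Imp: "x \<preceq> Imp (Imp x y) y"
  using le_trans [OF le_weak le_luk] .

lemma Imp_antimono_left: "a \<preceq> b \<Longrightarrow> Imp b c \<preceq> Imp a c"
  using Imp_le_trans Imp_le_ImpD by blast

text \<open>Transitivity gives a premise \<open>Imp (Imp y z) z\<close> in place of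
  \<open>y\<close>, and \<open>y\<close> lies below that formula.\<close>

lemma exchange_le: "Imp x (Imp y z) \<preceq> Imp y (Imp x z)"
  using le_trans [OF Imp_le_trans Imp_antimono_left [OF le_Imp_Imp]] .

lemma exchange: "Imp x (Imp y z) \<simeq> Imp y (Imp x z)"
  by (simp add: eqv_def exchange_le)

lemma exchange_rule: "x \<preceq> Imp y z \<Longrightarrow> y \<preceq> Imp x z"
  using exchange_le Imp_le_ImpD by blast

lemma Imp_mono_right: "a \<preceq> b \<Longrightarrow> Imp c a \<preceq> Imp c b"
  using exchange_rule [OF Imp_le_trans] Imp_le_ImpD by blast

lemma Imp_mono: "a' \<preceq> a \<Longrightarrow> b \<preceq> b' \<Longrightarrow> Imp a b \<preceq> Imp a' b'"
  using Imp_antimono_left Imp_mono_right le_trans by blast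

lemma Imp_cong: "a \<simeq> a' \<Longrightarrow> b \<simeq> b' \<Longrightarrow> Imp a b \<simeq> Imp a' b'"
  by (simp add: eqv_def Imp_mono)

section \<open>Negation and contraposition\<close>

lemma Neg_Neg_le: "Neg (Neg a) \<preceq> a"
proof -
  \<comment> \<open>Prefixing \<open>Neg (Neg a)\<close> by the double negation of a theorem lets
    contraposition strip both negations.\<close>
  have t: "provable S (Imp Bot Bot)" by (rule ax_bot)
  have "Neg (Neg a) \<preceq> Imp (Neg (Neg (Imp Bot Bot))) (Neg (Neg a))" by (rule le_weak)
  also have "\<dots> \<preceq> Imp (Neg a) (Neg (Imp Bot Bot))" by (rule le_contra)
  also have "\<dots> \<preceq> Imp (Imp Bot Bot) a" by (rule le_contra)
  also have "\<dots> \<preceq> a" by (rule Imp_theorem_le [OF t])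
  finally show ?thesis .
qed

lemma Neg_Neg: "Neg (Neg a) \<simeq> a"
  unfolding eqv_def using Neg_Neg_le le_contra Imp_le_ImpD by blast

lemma contraposition_le: "Imp a b \<preceq> Imp (Neg b) (Neg a)"
proof -
  have "Imp a b \<preceq> Imp (Neg (Neg a)) (Neg (Neg b))"
    by (intro Imp_mono eqvD1 [OF Neg_Neg] eqvD2 [OF Neg_Neg])
  also have "\<dots> \<preceq> Imp (Neg b) (Neg a)" by (rule le_contra)
  finally show ?thesis .
qed

lemma Neg_antimono: "a \<preceq> b \<Longrightarrow> Neg b \<preceq> Neg a"
  using contraposition_le Imp_le_ImpD by blast

lemma Neg_cong: "a \<simeq> b \<Longrightarrow> Neg a \<simeq> Neg b"
  by (simp add: eqv_def Neg_antimono)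

lemma le_Neg_swap: "a \<preceq> Neg b \<Longrightarrow> b \<preceq> Neg a"
  using Neg_antimono [of a "Neg b"] eqvD2 [OF Neg_Neg] le_trans by blast

lemma provable_Neg_Bot: "provable S (Neg Bot)"
  using le_Neg_swap [OF Bot_le] le_mp ax_bot by blast

section \<open>Joins and prelinearity\<close>

lemma Vee_commute: "Vee a b \<preceq> Vee b a"
  unfolding Vee_def by (rule le_luk)

lemma le_Vee1: "a \<preceq> Vee a b"
  unfolding Vee_def by (rule le_Imp_Imp)

lemma le_Vee2: "b \<preceq> Vee a b"
  unfolding Vee_def by (rule le_weak)

text \<open>Enlarge \<open>a\<close> to \<open>c\<close>, then commute: since \<open>b\<close> lies
  below \<open>c\<close>, the join of \<open>b\<close> and \<open>c\<close> collapses to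
  \<open>c\<close>.\<close>

lemma Vee_least:
  assumes "a \<preceq> c" "b \<preceq> c"
  shows "Vee a b \<preceq> c"
proof -
  have "Vee a b \<preceq> Vee c b"
    unfolding Vee_def by (intro Imp_antimono_left assms)
  also have "\<dots> \<preceq> Vee b c" by (rule Vee_commute)
  also have "\<dots> \<preceq> c"
    unfolding Vee_def by (rule Imp_theorem_le [OF assms(2) [unfolded le_def]])
  finally show ?thesis .
qed

text \<open>Modus ponens with a fixed disjunct \<open>y\<close> carried along; it replaces each
  modus ponens in \<open>provable_insert_Vee\<close>.\<close>

lemma Vee_modus_ponens: "Vee a y \<preceq> Imp (Vee (Imp a b) y) (Vee b y)"
proof (rule Vee_least)
  show "y \<preceq> Imp (Vee (Imp a b) y) (Vee b y)"
    by (rule le_trans [OF le_Vee2 le_weak])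
  have "Vee (Imp a b) y \<preceq> Imp a (Vee b y)"
  proof (rule Vee_least)
    show "Imp a b \<preceq> Imp a (Vee b y)"
      by (rule Imp_mono_right) (rule le_Vee1)
    show "y \<preceq> Imp a (Vee b y)"
      by (rule le_trans [OF le_Vee2 le_weak])
  qed
  then show "a \<preceq> Imp (Vee (Imp a b) y) (Vee b y)"
    by (rule exchange_rule)
qed

text \<open>The meet of \<open>y\<close> and \<open>z\<close> can be computed from either side: the hypothesis and the
  conclusion both say that it lies below \<open>x\<close>.\<close>

lemma meet_le_commute:
  assumes "z \<preceq> Imp (Imp z y) x"
  shows "y \<preceq> Imp (Imp y z) x"
proof -
  have "Imp z y \<preceq> Imp z x"
    using assms by (rule exchange_rule)
  also have "\<dots> \<preceq> Imp (Neg x) (Neg z)" by (rule contraposition_le)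
  finally have "Neg x \<preceq> Imp (Imp z y) (Neg z)" by (rule exchange_rule)
  also have "\<dots> \<preceq> Imp (Imp (Neg y) (Neg z)) (Neg z)"
    by (rule Imp_antimono_left) (rule le_contra)
  also have "\<dots> \<preceq> Imp (Imp (Neg z) (Neg y)) (Neg y)" by (rule le_luk)
  also have "\<dots> \<preceq> Imp (Imp y z) (Neg y)"
    by (rule Imp_antimono_left) (rule contraposition_le)
  finally have "Imp y z \<preceq> Imp (Neg x) (Neg y)" by (rule exchange_rule)
  also have "\<dots> \<preceq> Imp y x" by (rule le_contra)
  finally show ?thesis by (rule exchange_rule)
qed

text \<open>Expanding the join, exchange rewrites its premise as \<open>Imp y z\<close> with
  \<open>z = Imp (Imp x y) x\<close>. The meet of \<open>z\<close> and \<open>y\<close> lies below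
  \<open>x\<close> because \<open>x\<close> lies below \<open>z\<close>; computed from the other
  side, this turns \<open>Imp y z\<close> into \<open>Imp y x\<close>.\<close>

lemma prelinearity: "provable S (Vee (Imp x y) (Imp y x))"
proof -
  define z where "z = Imp (Imp x y) x"
  have "x \<preceq> z" unfolding z_def by (rule le_weak)
  then have "Imp z y \<preceq> Imp x y" by (rule Imp_antimono_left)
  then have "z \<preceq> Imp (Imp z y) x" unfolding z_def by (rule Imp_antimono_left)
  then have "y \<preceq> Imp (Imp y z) x" by (rule meet_le_commute)
  then have "Imp y z \<preceq> Imp y x" by (rule exchange_rule)
  moreover have "Imp (Imp x y) (Imp y x) \<preceq> Imp y z"
    unfolding z_def by (rule exchange_le)
  ultimately show ?thesis unfolding Vee_def using le_trans le_def by blast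
qed

section \<open>Truncated addition\<close>

lemma Oplus_mono: "a \<preceq> a' \<Longrightarrow> b \<preceq> b' \<Longrightarrow> Oplus a b \<preceq> Oplus a' b'"
  unfolding Oplus_def by (intro Imp_mono Neg_antimono)

lemma Oplus_cong: "a \<simeq> a' \<Longrightarrow> b \<simeq> b' \<Longrightarrow> Oplus a b \<simeq> Oplus a' b'"
  by (simp add: eqv_def Oplus_mono)

lemma Oplus_commute: "Oplus a b \<simeq> Oplus b a"
proof -
  have "Oplus x y \<preceq> Oplus y x" for x y
    unfolding Oplus_def
    by (rule le_trans [OF contraposition_le Imp_mono_right]) (rule Neg_Neg_le)
  then show ?thesis by (simp add: eqv_def)
qed

lemma Oplus_left_commute: "Oplus a (Oplus b c) \<simeq> Oplus b (Oplus a c)"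
  unfolding Oplus_def by (rule exchange)

lemma Oplus_assoc: "Oplus (Oplus a b) c \<simeq> Oplus a (Oplus b c)"
proof -
  have "Oplus (Oplus a b) c \<simeq> Oplus c (Oplus a b)" by (rule Oplus_commute)
  also have "\<dots> \<simeq> Oplus a (Oplus c b)" by (rule Oplus_left_commute)
  also have "\<dots> \<simeq> Oplus a (Oplus b c)"
    by (intro Oplus_cong Oplus_commute eqv_refl)
  finally show ?thesis .
qed

lemma Oplus_Bot_left: "Oplus Bot a \<simeq> a"
  unfolding Oplus_def by (simp add: eqv_def Imp_theorem_le provable_Neg_Bot le_weak)

lemma le_Oplus: "a \<preceq> Oplus b a"
  unfolding Oplus_def by (rule le_weak)

text \<open>\<open>x \<preceq> Neg y\<close> says that \<open>x\<close> and \<open>y\<close> have truncated product \<open>0\<close>, i.e. that their sum does not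
  overflow.  The next two lemmas are the associativity and cancellation laws of this
  partial addition.\<close>

lemma orthogonal_assoc:
  assumes "x \<preceq> Neg (Oplus y z)" "y \<preceq> Neg z"
  shows "Oplus x y \<preceq> Neg z"
proof -
  have "Oplus x y \<preceq> Oplus (Neg (Oplus y z)) y"
    by (intro Oplus_mono assms le_refl)
  also have "\<dots> \<preceq> Imp (Oplus y z) y"
    unfolding Oplus_def by (intro Imp_antimono_left eqvD2 [OF Neg_Neg])
  also have "\<dots> \<preceq> Imp (Oplus z y) y"
    by (intro Imp_antimono_left eqvD1 [OF Oplus_commute])
  also have "\<dots> \<preceq> Imp (Imp y (Neg z)) (Neg z)"
    unfolding Oplus_def by (rule le_luk)
  also have "\<dots> \<preceq> Neg z"
    by (rule Imp_theorem_le [OF assms(2) [unfolded le_def]])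
  finally show ?thesis .
qed

lemma Neg_Oplus_cancel:
  assumes "u \<preceq> Neg q" "Neg (Oplus u q) \<simeq> w"
  shows "Neg u \<simeq> Oplus q w"
proof -
  have "Oplus q w \<simeq> Oplus w q" by (rule Oplus_commute)
  also have "\<dots> \<simeq> Oplus (Neg (Oplus u q)) q"
    by (intro Oplus_cong eqv_refl eqv_sym [OF assms(2)])
  also have "\<dots> \<simeq> Vee (Neg u) q"
    unfolding Oplus_def Vee_def by (intro Imp_cong Neg_Neg eqv_refl)
  also have "\<dots> \<simeq> Neg u"
    using assms(1) by (simp add: eqv_def Vee_least le_Neg_swap le_Vee1 le_refl)
  finally show ?thesis by (rule eqv_sym)
qed

end

section \<open>Linear extensions and soundness\<close>

lemma provable_mono: "provable S a \<Longrightarrow> S \<subseteq> S' \<Longrightarrow> provable S' a"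
  by (induction rule: provable.induct) (auto intro: provable.intros)

text \<open>A substitute for the deduction theorem, which fails in this logic: join \<open>y\<close>
  to every line of a derivation.\<close>

lemma provable_insert_Vee:
  assumes "provable (insert x S) a"
  shows "provable (insert (Vee x y) S) (Vee a y)"
proof -
  interpret derivability "insert (Vee x y) S" .
  have weaken: "provable (insert (Vee x y) S) (Vee a y)" if "provable (insert (Vee x y) S) a" for a
    using that le_Vee1 by (rule le_mp)
  show ?thesis
    using assms
  proof (induction rule: provable.induct)
    case (assumption a)
    then show ?case
      by (auto intro: weaken provable.assumption)
  next
    case (mp a b)
    then show ?case
      using le_mp [OF mp.IH(2) le_mp_Imp [OF mp.IH(1) Vee_modus_ponens]] by simp
  qed (rule weaken, rule provable.intros)+
qed

text \<open>Trade the disjunct \<open>x\<close> for \<open>a\<close>, then \<open>y\<close> for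
  \<open>a\<close>, and use idempotence of the join.\<close>

lemma proof_by_cases:
  assumes "provable (insert x S) a" "provable (insert y S) a" "provable S (Vee x y)"
  shows "provable S a"
proof -
  interpret derivability S .
  have cut: "provable S d" if "provable (insert c S) d" "provable S c" for c d
    using that by (induction rule: provable.induct) (auto intro: provable.intros)
  have "provable S (Vee a y)"
    using provable_insert_Vee [OF assms(1)] assms(3) by (rule cut)
  have "provable (insert (Vee y a) S) (Vee a a)"
    using assms(2) by (rule provable_insert_Vee)
  moreover have "provable S (Vee y a)"
    using \<open>provable S (Vee a y)\<close> Vee_commute by (rule le_mp)
  ultimately have "provable S (Vee a a)"
    by (rule cut)
  then show ?thesis
    by (rule le_mp) (intro Vee_least le_refl)
qed

text \<open>A derivation is finite; at modus ponens the larger of two chain members serves both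
  premises.\<close>

lemma provable_Union_chain:
  assumes "provable (\<Union>C) a" "C \<noteq> {}" "\<And>X Y. X \<in> C \<Longrightarrow> Y \<in> C \<Longrightarrow> X \<subseteq> Y \<or> Y \<subseteq> X"
  shows "\<exists>X\<in>C. provable X a"
  using assms(1)
proof (induction rule: provable.induct)
  case (mp a b)
  then obtain X Y where "X \<in> C" "provable X a" "Y \<in> C" "provable Y (Imp a b)"
    by blast
  then show ?case
    using assms(3) [of X Y] provable_mono [of X] provable_mono [of Y] provable.mp [of _ a b] by blast
qed (use assms(2) in \<open>auto intro: provable.intros\<close>)

locale linear_theory = derivability +
  assumes linear: "provable S (Imp a b) \<or> provable S (Imp b a)"

text \<open>By Zorn take \<open>T\<close> maximal among the extensions not deriving
  \<open>\<phi>\<close>. If neither implication between \<open>a\<close> and \<open>b\<close> were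
  derivable, adding either one would derive \<open>\<phi>\<close>, so prelinearity and proof by
  cases would derive it from \<open>T\<close>.\<close>

lemma linear_extension:
  assumes "\<not> provable S \<phi>"
  obtains T where "S \<subseteq> T" "\<not> provable T \<phi>" "linear_theory T"
proof -
  define \<A> where "\<A> = {X. S \<subseteq> X \<and> \<not> provable X \<phi>}"
  have "\<exists>T\<in>\<A>. \<forall>X\<in>\<A>. T \<subseteq> X \<longrightarrow> X = T"
  proof (rule subset_Zorn_nonempty)
    show "\<A> \<noteq> {}"
      using assms by (auto simp: \<A>_def)
    fix C assume C: "C \<noteq> {}" "subset.chain \<A> C"
    then have sub: "C \<subseteq> \<A>" and chain: "\<And>X Y. X \<in> C \<Longrightarrow> Y \<in> C \<Longrightarrow> X \<subseteq> Y \<or> Y \<subseteq> X"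
      by (auto simp: subset_chain_def)
    have "\<not> provable (\<Union>C) \<phi>"
    proof
      assume "provable (\<Union>C) \<phi>"
      then obtain X where "X \<in> C" "provable X \<phi>"
        using provable_Union_chain [OF _ C(1) chain] by metis
      then show False using sub by (auto simp: \<A>_def)
    qed
    moreover have "S \<subseteq> \<Union>C"
      using C(1) sub by (auto simp: \<A>_def)
    ultimately show "\<Union>C \<in> \<A>"
      by (simp add: \<A>_def)
  qed
  then obtain T where T: "S \<subseteq> T" "\<not> provable T \<phi>"
    and max: "\<And>X. T \<subseteq> X \<Longrightarrow> \<not> provable X \<phi> \<Longrightarrow> X = T"
    by (auto simp: \<A>_def)
  interpret derivability T .
  have "linear_theory T"
  proof
    fix a b
    show "provable T (Imp a b) \<or> provable T (Imp b a)"
    proof (rule ccontr)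
      assume *: "\<not> (provable T (Imp a b) \<or> provable T (Imp b a))"
      have "provable (insert c T) \<phi>" if "\<not> provable T c" for c
      proof (rule ccontr)
        assume "\<not> provable (insert c T) \<phi>"
        then have "insert c T = T" by (intro max) auto
        then show False using that provable.assumption [of c T] by blast
      qed
      then have "provable T \<phi>"
        using * by (intro proof_by_cases [OF _ _ prelinearity]) auto
      then show False using T(2) by contradiction
    qed
  qed
  then show thesis
    using T that by blast
qed

section \<open>Real evaluations and soundness\<close>

primrec ev :: "(nat \<Rightarrow> real) \<Rightarrow> fm \<Rightarrow> real" where
  "ev v (Var i) = v i"
| "ev v Bot = 0"
| "ev v (Neg a) = 1 - ev v a"
| "ev v (Imp a b) = min 1 (1 - ev v a + ev v b)"

lemma ev_mem: "(\<And>i. v i \<in> {0..1}) \<Longrightarrow> ev v a \<in> {0..1}"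
  by (induction a) auto

lemma evaluation_ev: "(\<And>i. v i \<in> {0..1}) \<Longrightarrow> evaluation (ev v)"
  unfolding evaluation_def using ev_mem by auto

lemma evaluation_eqI:
  assumes "evaluation \<mu>" "\<And>i. i \<in> vars a \<Longrightarrow> \<mu> (Var i) = v i"
  shows "\<mu> a = ev v a"
  using assms by (induction a) (auto simp: evaluation_def)

lemma ev_Vee [simp]: "ev v (Vee a b) = max (ev v a) (ev v b)" if "ev v a \<le> 1" "ev v b \<le> 1"
  using that by (auto simp: Vee_def)

lemma ev_Oplus [simp]: "ev v (Oplus a b) = min 1 (ev v a + ev v b)"
  by (simp add: Oplus_def)

lemma soundness:
  assumes "provable S a" "\<And>b. b \<in> S \<Longrightarrow> ev v b = 1" "\<And>i. v i \<in> {0..1}"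
  shows "ev v a = 1"
proof -
  have m: "0 \<le> ev v b \<and> ev v b \<le> 1" for b
    using ev_mem assms(3) by auto
  show ?thesis
    using assms(1)
  proof (induction rule: provable.induct)
    case (ax_trans a b c)
    show ?case using m [of a] m [of b] m [of c] by (auto simp: min_def)
  next
    case (ax_luk a b)
    show ?case using m [of a] m [of b] by (auto simp: min_def)
  next
    case (mp a b)
    then show ?case using m [of a] m [of b] by (auto simp: min_def)
  next
    case (ax_weak a b)
    show ?case using m [of a] m [of b] by (auto simp: min_def)
  qed (use m assms(2) in auto)
qed

section \<open>Farey subdivision\<close>

text \<open>The truncated sum \<open>i p + j q\<close>, built with the copies of \<open>q\<close>
  innermost.\<close>

definition comb :: "fm \<Rightarrow> fm \<Rightarrow> nat \<Rightarrow> nat \<Rightarrow> fm" where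
  "comb p q i j = (Oplus p ^^ i) ((Oplus q ^^ j) Bot)"

lemma comb_simps [simp]:
  "comb p q 0 0 = Bot"
  "comb p q (Suc i) j = Oplus p (comb p q i j)"
  "comb p q 0 (Suc j) = Oplus q (comb p q 0 j)"
  by (simp_all add: comb_def)

section \<open>Natural combinations and partitions of unity\<close>

context derivability
begin

lemma comb_Suc_right: "comb p q i (Suc j) \<simeq> Oplus q (comb p q i j)"
proof (induction i)
  case 0
  show ?case by (simp add: eqv_refl)
next
  case (Suc i)
  have "comb p q (Suc i) (Suc j) \<simeq> Oplus p (Oplus q (comb p q i j))"
    using Suc.IH by (simp add: Oplus_cong eqv_refl)
  also have "\<dots> \<simeq> Oplus q (comb p q (Suc i) j)"
    by (simp add: Oplus_left_commute)
  finally show ?case .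
qed

lemma comb_commute: "comb p q i j \<simeq> comb q p j i"
proof (induction j)
  case 0
  show ?case by (simp add: comb_def eqv_refl)
next
  case (Suc j)
  have "comb p q i (Suc j) \<simeq> Oplus q (comb p q i j)" by (rule comb_Suc_right)
  also have "\<dots> \<simeq> comb q p (Suc j) i"
    using Suc.IH by (simp add: Oplus_cong eqv_refl)
  finally show ?case .
qed

lemma comb_add: "Oplus (comb p q i j) (comb p q i' j') \<simeq> comb p q (i + i') (j + j')"
proof (induction i)
  case 0
  show ?case
  proof (induction j)
    case 0
    show ?case by (simp add: Oplus_Bot_left)
  next
    case (Suc j)
    have "Oplus (comb p q 0 (Suc j)) (comb p q i' j') \<simeq>
          Oplus q (Oplus (comb p q 0 j) (comb p q i' j'))"
      by (simp add: Oplus_assoc)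
    also have "\<dots> \<simeq> Oplus q (comb p q i' (j + j'))"
      using Suc.IH by (simp add: Oplus_cong eqv_refl)
    also have "\<dots> \<simeq> comb p q i' (Suc (j + j'))"
      by (rule eqv_sym) (rule comb_Suc_right)
    finally show ?case by simp
  qed
next
  case (Suc i)
  have "Oplus (comb p q (Suc i) j) (comb p q i' j') \<simeq>
        Oplus p (Oplus (comb p q i j) (comb p q i' j'))"
    by (simp add: Oplus_assoc)
  also have "\<dots> \<simeq> Oplus p (comb p q (i + i') (j + j'))"
    using Suc.IH by (simp add: Oplus_cong eqv_refl)
  finally show ?case by simp
qed

lemma comb_mono:
  assumes "i \<le> i'" "j \<le> j'"
  shows "comb p q i j \<preceq> comb p q i' j'"
proof -
  have "comb p q i j \<preceq> Oplus (comb p q (i' - i) (j' - j)) (comb p q i j)"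
    by (rule le_Oplus)
  also have "\<dots> \<simeq> comb p q i' j'"
    using comb_add [of p q "i' - i" "j' - j" i j] assms by simp
  finally show ?thesis .
qed

text \<open>Each copy of \<open>p\<close> contributes one \<open>p'\<close> and one further
  \<open>q\<close>.\<close>

lemma comb_refine:
  assumes "p \<simeq> Oplus p' q"
  shows "comb p q i j \<simeq> comb p' q i (i + j)"
proof (induction i)
  case 0
  show ?case by (simp add: comb_def eqv_refl)
next
  case (Suc i)
  have "comb p q (Suc i) j \<simeq> Oplus (Oplus p' q) (comb p' q i (i + j))"
    using Suc.IH assms by (simp add: Oplus_cong)
  also have "\<dots> \<simeq> Oplus p' (Oplus q (comb p' q i (i + j)))"
    by (rule Oplus_assoc)
  also have "\<dots> \<simeq> Oplus p' (comb p' q i (Suc (i + j)))"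
    by (intro Oplus_cong eqv_refl eqv_sym [OF comb_Suc_right])
  finally show ?case by simp
qed

text \<open>\<open>p\<close> taken \<open>m\<close> times and \<open>q\<close> taken \<open>n\<close> times add up to \<open>1\<close> without overflow.\<close>

definition unit_partition :: "nat \<Rightarrow> nat \<Rightarrow> fm \<Rightarrow> fm \<Rightarrow> bool" where
  "unit_partition m n p q \<longleftrightarrow> 0 < m \<and> 0 < n \<and> provable S (comb p q m n) \<and>
     comb p q (m - 1) n \<preceq> Neg p \<and> comb p q m (n - 1) \<preceq> Neg q"

lemma unit_partition_commute:
  assumes "unit_partition m n p q"
  shows "unit_partition n m q p"
proof -
  have "provable S (comb q p n m)"
    using assms le_mp [OF _ eqvD1 [OF comb_commute]] by (simp add: unit_partition_def)
  moreover have "comb q p (n - 1) m \<preceq> Neg q" "comb q p n (m - 1) \<preceq> Neg p"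
    using assms eqv_le_trans [OF comb_commute] by (simp_all add: unit_partition_def)
  ultimately show ?thesis
    using assms by (simp add: unit_partition_def)
qed

lemma Neg_theorem: "provable S t \<Longrightarrow> Neg t \<simeq> Bot"
  unfolding eqv_def
  by (intro conjI Bot_le le_trans [OF Neg_antimono [OF provable_le] Neg_Neg_le])

text \<open>Since the full sum does not overflow, its summands can be peeled off one by one; each
  one removed is added to the negation by \<open>Neg_Oplus_cancel\<close>.\<close>

lemma Neg_comb:
  assumes "unit_partition m n p q" "i \<le> m" "j \<le> n"
  shows "Neg (comb p q i j) \<simeq> comb p q (m - i) (n - j)"
proof -
  have m: "comb p q (m - 1) n \<preceq> Neg p" and n: "comb p q m (n - 1) \<preceq> Neg q"
    using assms(1) by (auto simp: unit_partition_def)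
  \<comment> \<open>First copies of \<open>q\<close> are removed with all copies of \<open>p\<close>
    present; the second induction then removes copies of \<open>p\<close>.\<close>
  have right: "Neg (comb p q m (n - b)) \<simeq> comb p q 0 b" if "b \<le> n" for b
    using that
  proof (induction b)
    case 0
    show ?case using assms(1) by (simp add: Neg_theorem unit_partition_def)
  next
    case (Suc b)
    let ?u = "comb p q m (n - Suc b)"
    have "?u \<preceq> comb p q m (n - 1)" by (rule comb_mono) auto
    then have u: "?u \<preceq> Neg q" using n by (rule le_trans)
    have "Oplus ?u q \<simeq> Oplus q ?u" by (rule Oplus_commute)
    also have "\<dots> \<simeq> comb p q m (Suc (n - Suc b))"
      by (rule eqv_sym) (rule comb_Suc_right)
    also have "Suc (n - Suc b) = n - b" using Suc.prems by simp
    finally have "Neg (Oplus ?u q) \<simeq> Neg (comb p q m (n - b))" by (rule Neg_cong)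
    also have "\<dots> \<simeq> comb p q 0 b" using Suc.prems by (intro Suc.IH) simp
    finally show ?case unfolding comb_simps by (rule Neg_Oplus_cancel [OF u])
  qed
  have "Neg (comb p q (m - a) (n - b)) \<simeq> comb p q a b" if "a \<le> m" "b \<le> n" for a b
    using that
  proof (induction a)
    case 0
    then show ?case using right by simp
  next
    case (Suc a)
    let ?u = "comb p q (m - Suc a) (n - b)"
    have "?u \<preceq> comb p q (m - 1) n" by (rule comb_mono) auto
    then have u: "?u \<preceq> Neg p" using m by (rule le_trans)
    have "Oplus ?u p \<simeq> comb p q (Suc (m - Suc a)) (n - b)"
      unfolding comb_simps by (rule Oplus_commute)
    also have "Suc (m - Suc a) = m - a" using Suc.prems by simp
    finally have "Neg (Oplus ?u p) \<simeq> Neg (comb p q (m - a) (n - b))" by (rule Neg_cong)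
    also have "\<dots> \<simeq> comb p q a b" using Suc.prems by (intro Suc.IH) simp_all
    finally show ?case unfolding comb_simps by (rule Neg_Oplus_cancel [OF u])
  qed
  from this [of "m - i" "n - j"] show ?thesis using assms by simp
qed

lemma unit_partition_refine:
  assumes "unit_partition m n p q" "p \<simeq> Oplus p' q" "p' \<preceq> Neg q"
  shows "unit_partition m (m + n) p' q"
proof -
  obtain k where k: "m = Suc k" using assms(1) by (cases m) (auto simp: unit_partition_def)
  \<comment> \<open>\<open>x\<close> is the full sum without one \<open>p\<close>. Removing one
    \<open>p'\<close> or one \<open>q\<close> from the refined sum leaves \<open>x\<close> plus the
    other one, and \<open>x\<close> is orthogonal to the sum of \<open>p'\<close> and
    \<open>q\<close>.\<close>
  define x where "x = comb p q k n"
  have "x \<preceq> Neg p" using assms(1) by (simp add: k x_def unit_partition_def)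
  also have "\<dots> \<simeq> Neg (Oplus p' q)" using assms(2) by (rule Neg_cong)
  finally have x1: "x \<preceq> Neg (Oplus p' q)" .
  also have "\<dots> \<simeq> Neg (Oplus q p')" by (intro Neg_cong Oplus_commute)
  finally have x2: "x \<preceq> Neg (Oplus q p')" .
  have x: "comb p' q k (k + n) \<simeq> x"
    unfolding x_def by (rule eqv_sym [OF comb_refine [OF assms(2)]])
  have "comb p' q k (m + n) \<simeq> Oplus q (comb p' q k (k + n))"
    using comb_Suc_right [of p' q k "k + n"] by (simp add: k)
  also have "\<dots> \<simeq> Oplus q x" using x by (intro Oplus_cong eqv_refl)
  also have "\<dots> \<simeq> Oplus x q" by (rule Oplus_commute)
  also have "\<dots> \<preceq> Neg p'"
    using x2 le_Neg_swap [OF assms(3)] by (rule orthogonal_assoc)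
  finally have 1: "comb p' q k (m + n) \<preceq> Neg p'" .
  have "comb p' q m (k + n) \<simeq> Oplus p' x" using x by (simp add: k Oplus_cong eqv_refl)
  also have "\<dots> \<simeq> Oplus x p'" by (rule Oplus_commute)
  also have "\<dots> \<preceq> Neg q" using x1 assms(3) by (rule orthogonal_assoc)
  finally have 2: "comb p' q m (k + n) \<preceq> Neg q" .
  have "provable S (comb p q m n)" using assms(1) by (simp add: unit_partition_def)
  then have "provable S (comb p' q m (m + n))"
    using comb_refine [OF assms(2), THEN eqvD1] by (rule le_mp)
  with 1 2 show ?thesis by (simp add: unit_partition_def k)
qed

end

text \<open>A chart is an interval of the real model space together with a two-element partition of
  unity \<open>p, q\<close> of the theory: the interval is parametrised by the values \<open>P, Q\<close> of \<open>p, q\<close>, and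
  a formula is linear in the chart if both sides agree that it equals \<open>i p + j q\<close>.\<close>

definition weights :: "nat \<Rightarrow> nat \<Rightarrow> (real \<times> real) set" where
  "weights m n = {(P, Q). 0 \<le> P \<and> 0 \<le> Q \<and> real m * P + real n * Q = 1}"

definition (in derivability) chart ::
    "(fm \<Rightarrow> real) set \<Rightarrow> nat \<Rightarrow> nat \<Rightarrow> fm \<Rightarrow> fm \<Rightarrow> (real \<Rightarrow> real \<Rightarrow> fm \<Rightarrow> real) \<Rightarrow> bool" where
  "chart M m n p q E \<longleftrightarrow> unit_partition m n p q \<and>
     (\<forall>(P, Q) \<in> weights m n. evaluation (E P Q) \<and> E P Q \<in> M)"

definition (in derivability) linear_in ::
    "nat \<Rightarrow> nat \<Rightarrow> fm \<Rightarrow> fm \<Rightarrow> (real \<Rightarrow> real \<Rightarrow> fm \<Rightarrow> real) \<Rightarrow> fm \<Rightarrow> nat \<Rightarrow> nat \<Rightarrow> bool" where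
  "linear_in m n p q E a i j \<longleftrightarrow> i \<le> m \<and> j \<le> n \<and> a \<simeq> comb p q i j \<and>
     (\<forall>(P, Q) \<in> weights m n. E P Q a = real i * P + real j * Q)"

definition (in derivability) linearizable :: "(fm \<Rightarrow> real) set \<Rightarrow> fm set \<Rightarrow> bool" where
  "linearizable M L \<longleftrightarrow>
     (\<exists>m n p q E. chart M m n p q E \<and> (\<forall>a\<in>L. \<exists>i j. linear_in m n p q E a i j))"

section \<open>Linearizing formulas by Farey steps\<close>

context linear_theory
begin

lemma le_linear: "a \<preceq> b \<or> b \<preceq> a"
  using linear by (simp add: le_def)

lemma chart_evaluation: "chart M m n p q E \<Longrightarrow> (P, Q) \<in> weights m n \<Longrightarrow> evaluation (E P Q)"
  by (auto simp: chart_def)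

lemma linear_in_eq:
  "linear_in m n p q E a i j \<Longrightarrow> (P, Q) \<in> weights m n \<Longrightarrow> E P Q a = real i * P + real j * Q"
  by (auto simp: linear_in_def)

lemma linear_in_Imp_eq:
  assumes "chart M m n p q E" "linear_in m n p q E a i j" "linear_in m n p q E b i' j'"
    and "(P, Q) \<in> weights m n"
  shows "E P Q (Imp a b) = min 1 (1 - (real i * P + real j * Q) + (real i' * P + real j' * Q))"
  using chart_evaluation [OF assms(1,4)] linear_in_eq [OF assms(2,4)] linear_in_eq [OF assms(3,4)]
  by (simp add: evaluation_def)

lemma chart_commute:
  "chart M m n p q E \<Longrightarrow> chart M n m q p (\<lambda>Q P. E P Q)"
  unfolding chart_def weights_def using unit_partition_commute by (auto simp: add.commute)

lemma linear_in_commute: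
  assumes "linear_in m n p q E a i j"
  shows "linear_in n m q p (\<lambda>Q P. E P Q) a j i"
  using assms eqv_trans [OF _ comb_commute] unfolding linear_in_def weights_def
  by (auto simp: add.commute)

text \<open>The Farey step: if \<open>q \<preceq> p\<close>, replace \<open>p\<close> by \<open>p - q\<close>.\<close>

lemma chart_refine:
  assumes "chart M m n p q E" "q \<preceq> p"
  defines "p' \<equiv> Neg (Imp p q)" and "E' \<equiv> \<lambda>P Q. E (P + Q) Q"
  shows "chart M m (m + n) p' q E'"
    and "linear_in m n p q E a i j \<Longrightarrow> linear_in m (m + n) p' q E' a i (i + j)"
proof -
  have "Oplus p' q \<simeq> Vee p q"
    unfolding p'_def Oplus_def Vee_def by (intro Imp_cong Neg_Neg eqv_refl)
  also have "\<dots> \<simeq> p"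
    using assms(2) by (simp add: eqv_def Vee_least le_Vee1 le_refl)
  finally have p: "p \<simeq> Oplus p' q" by (rule eqv_sym)
  have p': "p' \<preceq> Neg q"
    unfolding p'_def by (intro Neg_antimono le_weak)
  \<comment> \<open>The new parameter is the value of \<open>p - q\<close>, so \<open>P + Q\<close>
    recovers the value of \<open>p\<close>, and
    \<open>m (P + Q) + n Q = m P + (m + n) Q\<close>.\<close>
  have weights: "(P + Q, Q) \<in> weights m n" if "(P, Q) \<in> weights m (m + n)" for P Q
    using that by (auto simp: weights_def algebra_simps)
  show "chart M m (m + n) p' q E'"
    using assms(1) unit_partition_refine [OF _ p p'] weights
    unfolding chart_def E'_def by fast
  assume lin: "linear_in m n p q E a i j"
  have "a \<simeq> comb p' q i (i + j)"
    using lin eqv_trans [OF _ comb_refine [OF p]] by (simp add: linear_in_def)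
  moreover have "E' P Q a = real i * P + real (i + j) * Q" if "(P, Q) \<in> weights m (m + n)" for P Q
    using lin weights [OF that] by (auto simp: linear_in_def E'_def algebra_simps)
  ultimately show "linear_in m (m + n) p' q E' a i (i + j)"
    using lin by (auto simp: linear_in_def)
qed

lemma linear_in_Neg:
  assumes "chart M m n p q E" "linear_in m n p q E a i j"
  shows "linear_in m n p q E (Neg a) (m - i) (n - j)"
proof -
  have "Neg a \<simeq> Neg (comb p q i j)"
    using assms(2) by (intro Neg_cong) (simp add: linear_in_def)
  also have "\<dots> \<simeq> comb p q (m - i) (n - j)"
    using assms by (intro Neg_comb) (auto simp: chart_def linear_in_def)
  finally have "Neg a \<simeq> comb p q (m - i) (n - j)" .
  moreover have "E P Q (Neg a) = real (m - i) * P + real (n - j) * Q" if "(P, Q) \<in> weights m n" for P Q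
  proof -
    have "E P Q (Neg a) = 1 - (real i * P + real j * Q)"
      using chart_evaluation [OF assms(1) that] linear_in_eq [OF assms(2) that]
      by (simp add: evaluation_def)
    then show ?thesis
      using that assms(2) by (simp add: weights_def linear_in_def of_nat_diff left_diff_distrib)
  qed
  ultimately show ?thesis
    by (auto simp: linear_in_def)
qed

text \<open>Coefficientwise comparison makes the implication a theorem, and theorems carry the full
  coefficients \<open>(m, n)\<close>.\<close>

lemma linear_in_Imp_le:
  assumes "chart M m n p q E" "linear_in m n p q E a i j" "linear_in m n p q E b i' j'"
    and "i \<le> i'" "j \<le> j'"
  shows "linear_in m n p q E (Imp a b) m n"
proof -
  have "a \<simeq> comb p q i j" using assms(2) by (simp add: linear_in_def)
  also have "\<dots> \<preceq> comb p q i' j'" using assms by (intro comb_mono)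
  also have "\<dots> \<simeq> b" using assms(3) by (simp add: linear_in_def eqv_sym)
  finally have "provable S (Imp a b)" by (simp add: le_def)
  moreover have "provable S (comb p q m n)"
    using assms(1) by (simp add: chart_def unit_partition_def)
  ultimately have "Imp a b \<simeq> comb p q m n"
    by (simp add: eqv_def provable_le)
  moreover have "E P Q (Imp a b) = real m * P + real n * Q" if "(P, Q) \<in> weights m n" for P Q
  proof -
    have "real i * P + real j * Q \<le> real i' * P + real j' * Q"
      using that assms(4,5) by (intro add_mono mult_right_mono) (auto simp: weights_def)
    then show ?thesis
      using that linear_in_Imp_eq [OF assms(1-3) that] by (simp add: weights_def)
  qed
  ultimately show ?thesis by (auto simp: linear_in_def)
qed

text \<open>As \<open>b\<close> lies coefficientwise below \<open>a\<close>, the sum of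
  \<open>Neg a\<close> and \<open>b\<close> stays within \<open>(m, n)\<close> and is not
  truncated.\<close>

lemma linear_in_Imp_ge:
  assumes "chart M m n p q E" "linear_in m n p q E a i j" "linear_in m n p q E b i' j'"
    and "i' \<le> i" "j' \<le> j"
  shows "linear_in m n p q E (Imp a b) (m - i + i') (n - j + j')"
proof -
  have le: "i \<le> m" "j \<le> n"
    using assms(2) by (auto simp: linear_in_def)
  have "Imp a b \<simeq> Oplus (Neg a) b"
    unfolding Oplus_def by (intro Imp_cong eqv_refl eqv_sym [OF Neg_Neg])
  also have "\<dots> \<simeq> Oplus (comb p q (m - i) (n - j)) (comb p q i' j')"
    using linear_in_Neg [OF assms(1,2)] assms(3) by (intro Oplus_cong) (auto simp: linear_in_def)
  also have "\<dots> \<simeq> comb p q (m - i + i') (n - j + j')" by (rule comb_add)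
  finally have "Imp a b \<simeq> comb p q (m - i + i') (n - j + j')" .
  moreover have "E P Q (Imp a b) = real (m - i + i') * P + real (n - j + j') * Q"
    if "(P, Q) \<in> weights m n" for P Q
  proof -
    have "real i' * P + real j' * Q \<le> real i * P + real j * Q"
      using that assms(4,5) by (intro add_mono mult_right_mono) (auto simp: weights_def)
    moreover have "real (m - i + i') * P + real (n - j + j') * Q =
        (real m * P + real n * Q) - (real i * P + real j * Q) + (real i' * P + real j' * Q)"
      using le by (simp add: of_nat_diff algebra_simps)
    moreover have "real m * P + real n * Q = 1"
      using that by (simp add: weights_def)
    ultimately show ?thesis
      unfolding linear_in_Imp_eq [OF assms(1-3) that] by linarith
  qed
  ultimately show ?thesis
    using le assms(4,5) by (auto simp: linear_in_def)
qed

text \<open>If the coefficient vectors of \<open>a\<close> and \<open>b\<close> are incomparable, their differences \<open>d, e\<close> have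
  opposite signs, and a Farey step replaces \<open>d e\<close> by \<open>d (d + e)\<close> or \<open>(d + e) e\<close>.\<close>

lemma linearizable_Imp_aux:
  assumes "chart M m n p q E" "\<forall>c\<in>L. \<exists>i j. linear_in m n p q E c i j"
    and "linear_in m n p q E a i j" "linear_in m n p q E b i' j'"
  shows "linearizable M (insert (Imp a b) L)"
  using assms
proof (induction "nat (- ((int i' - int i) * (int j' - int j)))"
    arbitrary: m n p q E i j i' j' rule: less_induct)
  case less
  note chart = less.prems(1) and L = less.prems(2) and ab = less.prems(3,4)
  consider "i \<le> i'" "j \<le> j'" | "i' \<le> i" "j' \<le> j"
    | "(int i' - int i) * (int j' - int j) < 0"
    by (simp add: mult_less_0_iff) linarith
  then show ?case
  proof cases
    case 1
    then show ?thesis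
      using linear_in_Imp_le [OF chart ab] chart L unfolding linearizable_def by blast
  next
    case 2
    then show ?thesis
      using linear_in_Imp_ge [OF chart ab] chart L unfolding linearizable_def by blast
  next
    case 3
    define d e where "d = int i' - int i" and "e = int j' - int j"
    have de: "d * e < 0" and "d \<noteq> 0" "e \<noteq> 0"
      using 3 by (auto simp: d_def e_def)
    then have "d * d > 0" "e * e > 0"
      by (simp_all add: zero_less_mult_iff) linarith+
    \<comment> \<open>As \<open>d * e\<close> is negative, adding the positive \<open>d * d\<close>
      or \<open>e * e\<close> moves it up, and cutting off at 0 keeps the decrease strict.\<close>
    then have decrease: "nat (- (d * (d + e))) < nat (- (d * e))" "nat (- (e * (d + e))) < nat (- (d * e))"
      using de by (simp_all add: algebra_simps)
    \<comment> \<open>Linearity of the theory decides which of \<open>p, q\<close> the other is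
      subtracted from.\<close>
    show ?thesis
      using le_linear [of q p]
    proof
      assume "q \<preceq> p"
      note refine = chart_refine [OF chart this]
      show ?thesis
      proof (rule less.hyps [OF _ refine(1)])
        show "linear_in m (m + n) (Neg (Imp p q)) q (\<lambda>P Q. E (P + Q) Q) a i (i + j)"
          "linear_in m (m + n) (Neg (Imp p q)) q (\<lambda>P Q. E (P + Q) Q) b i' (i' + j')"
          using ab by (auto intro: refine(2))
        show "nat (- ((int i' - int i) * (int (i' + j') - int (i + j))))
            < nat (- ((int i' - int i) * (int j' - int j)))"
          using decrease(1) by (simp add: d_def e_def algebra_simps)
        show "\<forall>c\<in>L. \<exists>i j. linear_in m (m + n) (Neg (Imp p q)) q (\<lambda>P Q. E (P + Q) Q) c i j"
          using L refine(2) by blast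
      qed
    next
      assume "p \<preceq> q"
      note refine = chart_refine [OF chart_commute [OF chart] this]
      show ?thesis
      proof (rule less.hyps [OF _ refine(1)])
        show "linear_in n (n + m) (Neg (Imp q p)) p (\<lambda>Q P. E P (Q + P)) a j (j + i)"
          "linear_in n (n + m) (Neg (Imp q p)) p (\<lambda>Q P. E P (Q + P)) b j' (j' + i')"
          using ab by (auto intro: refine(2) linear_in_commute)
        show "nat (- ((int j' - int j) * (int (j' + i') - int (j + i))))
            < nat (- ((int i' - int i) * (int j' - int j)))"
          using decrease(2) by (simp add: d_def e_def algebra_simps)
        show "\<forall>c\<in>L. \<exists>i j. linear_in n (n + m) (Neg (Imp q p)) p (\<lambda>Q P. E P (Q + P)) c i j"
          using L refine(2) linear_in_commute by blast
      qed
    qed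
  qed
qed

text \<open>Only an implication step changes the chart, and refinement preserves linearity; carrying
  \<open>L\<close> along therefore brings both subformulas into one chart.\<close>

lemma linearizable_formula:
  assumes "linearizable M L" "Var ` vars a \<subseteq> L"
  shows "linearizable M (insert a L)"
  using assms
proof (induction a arbitrary: L)
  case (Var k)
  then show ?case by (simp add: insert_absorb)
next
  case Bot
  then obtain m n p q E where *: "chart M m n p q E" "\<forall>a\<in>L. \<exists>i j. linear_in m n p q E a i j"
    unfolding linearizable_def by blast
  then have "linear_in m n p q E Bot 0 0"
    by (auto simp: linear_in_def eqv_refl chart_def evaluation_def)
  with * show ?case unfolding linearizable_def by blast
next
  case (Neg a)
  then have "linearizable M (insert a L)" by simp
  then obtain m n p q E where
    *: "chart M m n p q E" "\<forall>a\<in>insert a L. \<exists>i j. linear_in m n p q E a i j"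
    unfolding linearizable_def by blast
  then have "\<exists>i j. linear_in m n p q E (Neg a) i j"
    using linear_in_Neg by blast
  with * show ?case unfolding linearizable_def by blast
next
  case (Imp a b)
  then have "linearizable M (insert b (insert a L))"
    by (simp add: image_Un subset_insertI2)
  then obtain m n p q E where *: "chart M m n p q E" "\<forall>c\<in>L. \<exists>i j. linear_in m n p q E c i j"
    "\<exists>i j. linear_in m n p q E a i j" "\<exists>i j. linear_in m n p q E b i j"
    unfolding linearizable_def by blast
  then show ?case using linearizable_Imp_aux by blast
qed

text \<open>Coefficients \<open>(m, n)\<close> would make \<open>a\<close> a theorem, so one of them
  is smaller; the end of the segment where only that parameter is nonzero gives \<open>a\<close> the
  value \<open>i / m\<close> or \<open>j / n\<close>, below 1.\<close>

lemma linearizable_countermodel: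
  assumes "linearizable M {a}" "\<not> provable S a"
  obtains \<mu> where "\<mu> \<in> M" "evaluation \<mu>" "\<mu> a \<noteq> 1"
proof -
  obtain m n p q E i j where chart: "chart M m n p q E" and lin: "linear_in m n p q E a i j"
    using assms(1) unfolding linearizable_def by blast
  have mn: "0 < m" "0 < n" "provable S (comb p q m n)"
    using chart by (auto simp: chart_def unit_partition_def)
  have "\<not> (i = m \<and> j = n)"
    using lin le_mp [OF mn(3)] assms(2) eqvD2 by (auto simp: linear_in_def)
  then consider "i < m" | "j < n"
    using lin by (force simp: linear_in_def)
  then obtain P Q where "(P, Q) \<in> weights m n" "real i * P + real j * Q \<noteq> 1"
  proof cases
    case 1
    then show ?thesis using mn by (intro that [of "1 / real m" 0]) (auto simp: weights_def)
  next
    case 2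
    then show ?thesis using mn by (intro that [of 0 "1 / real n"]) (auto simp: weights_def)
  qed
  then show thesis
    using chart lin by (intro that [of "E P Q"]) (auto simp: chart_def linear_in_def)
qed

end

section \<open>Completeness for the path\<close>

lemma rho_1: "rho (Suc 0) = Var 1"
  by (simp add: rho_def)

lemma rho_Suc: "1 \<le> n \<Longrightarrow> rho (Suc n) = Oplus (rho n) (Var (Suc n))"
  by (simp add: rho_def)

lemma ev_rho:
  assumes "1 \<le> n" "\<And>k. k \<in> {1..n} \<Longrightarrow> v k \<in> {0..1}"
  shows "ev v (rho n) = min 1 (\<Sum>k=1..n. v k)"
  using assms
proof (induction n rule: nat_induct_at_least)
  case base
  then show ?case by (simp add: rho_1)
next
  case (Suc n)
  then have "ev v (rho n) = min 1 (\<Sum>k=1..n. v k)" "v (Suc n) \<in> {0..1}"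
    by auto
  then show ?case using Suc.hyps by (auto simp: rho_Suc min_def)
qed

lemma vars_rho: "1 \<le> n \<Longrightarrow> vars (rho n) \<subseteq> {1..n}"
proof (induction n rule: nat_induct_at_least)
  case base
  then show ?case by (simp add: rho_1)
next
  case (Suc n)
  then show ?case by (auto simp: rho_Suc Oplus_def)
qed

lemma AA_subset_formulas: "1 \<le> n \<Longrightarrow> AA n \<subseteq> formulas n"
  using vars_rho by (auto simp: AA_def formulas_def Odot_def Wedge_def Vee_def)

lemma rho_in_AA: "rho n \<in> AA n"
  by (simp add: AA_def)

lemma Neg_Odot_in_AA: "i \<in> {1..<n} \<Longrightarrow> Neg (Odot (Var i) (Var (i + 1))) \<in> AA n"
  unfolding AA_def by force

lemma Neg_Wedge_in_AA:
  assumes "j \<in> {1..n}" "k \<in> {1..n}" "\<not> \<bar>int j - int k\<bar> \<le> 1"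
  shows "Neg (Wedge (Var j) (Var k)) \<in> AA n"
  using assms unfolding AA_def by (intro UnI2 CollectI exI [of _ j] exI [of _ k]) simp

text \<open>The piecewise linear path through the unit vectors \<open>e\<^sub>1, \<dots>, e\<^sub>n\<close>, in this order.\<close>

definition on_path :: "nat \<Rightarrow> (nat \<Rightarrow> real) \<Rightarrow> bool" where
  "on_path n v \<longleftrightarrow> (\<exists>i\<in>{1..<n}. v i \<in> {0..1} \<and> v (i + 1) = 1 - v i \<and>
     (\<forall>k\<in>{1..n}. k \<noteq> i \<longrightarrow> k \<noteq> i + 1 \<longrightarrow> v k = 0))"

lemma on_path_mem: "on_path n v \<Longrightarrow> k \<in> {1..n} \<Longrightarrow> v k \<in> {0..1}"
  unfolding on_path_def by fastforce

lemma on_path_cong: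
  assumes "on_path n v" "\<And>k. k \<in> {1..n} \<Longrightarrow> w k = v k"
  shows "on_path n w"
  using assms unfolding on_path_def by fastforce

lemma sum_two_terms:
  fixes g :: "nat \<Rightarrow> real"
  assumes "i \<in> {1..<n}" "\<And>k. k \<in> {1..n} \<Longrightarrow> k \<noteq> i \<Longrightarrow> k \<noteq> i + 1 \<Longrightarrow> g k = 0"
  shows "(\<Sum>k=1..n. g k) = g i + g (i + 1)"
proof -
  have "(\<Sum>k=1..n. g k) = (\<Sum>k\<in>{i, i + 1}. g k)"
    using assms by (intro sum.mono_neutral_right) auto
  then show ?thesis by simp
qed

lemma ev_Odot: "ev v (Odot a b) = max 0 (ev v a + ev v b - 1)"
  by (simp add: Odot_def min_def max_def)

lemma ev_Wedge:
  "0 \<le> ev v a \<Longrightarrow> 0 \<le> ev v b \<Longrightarrow> ev v (Wedge a b) = min (ev v a) (ev v b)"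
  by (simp add: Wedge_def min_def max_def)

lemma ev_AA:
  assumes "on_path n v" "a \<in> AA n"
  shows "ev v a = 1"
proof -
  obtain i where i: "i \<in> {1..<n}" "v i \<in> {0..1}" "v (i + 1) = 1 - v i"
    and zero: "\<And>k. k \<in> {1..n} \<Longrightarrow> k \<noteq> i \<Longrightarrow> k \<noteq> i + 1 \<Longrightarrow> v k = 0"
    using assms(1) unfolding on_path_def by blast
  note mem = on_path_mem [OF assms(1)]
  from assms(2) consider "a = rho n"
    | j k where "a = Neg (Odot (Var j) (Var k))" "j \<in> {1..n}" "k \<in> {1..n}" "\<bar>int j - int k\<bar> = 1"
    | j k where "a = Neg (Wedge (Var j) (Var k))" "j \<in> {1..n}" "k \<in> {1..n}" "\<bar>int j - int k\<bar> > 1"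
    unfolding AA_def by blast
  then show ?thesis
  proof cases
    case 1
    have "(\<Sum>k=1..n. v k) = 1"
      using sum_two_terms [OF i(1) zero] i(3) by simp
    then show ?thesis
      using ev_rho [of n v] mem i(1) 1 by simp
  next
    case 2
    then have "v j + v k \<le> 1"
      using zero [of j] zero [of k] mem [of j] mem [of k] i(3)
      by (cases "j = i"; cases "k = i"; cases "j = i + 1"; cases "k = i + 1") auto
    then show ?thesis using 2 by (simp add: ev_Odot)
  next
    case 3
    then have "v j = 0 \<or> v k = 0"
      using zero [of j] zero [of k]
      by (cases "j = i"; cases "k = i"; cases "j = i + 1"; cases "k = i + 1") auto
    then show ?thesis using 3 mem [of j] mem [of k] by (auto simp: ev_Wedge)
  qed
qed

text \<open>Serves for the support of a point and for the variables a theory does not refute: the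
  least member and its successor exhaust the set.\<close>

lemma pairwise_adjacent:
  fixes n :: nat
  assumes "2 \<le> n" "N \<subseteq> {1..n}" "\<And>j k. j \<in> N \<Longrightarrow> k \<in> N \<Longrightarrow> \<bar>int j - int k\<bar> \<le> 1"
  obtains i where "i \<in> {1..<n}" "N \<subseteq> {i, i + 1}"
proof (cases "N = {}")
  case True
  then show ?thesis using assms(1) that [of 1] by auto
next
  case False
  define m where "m = (LEAST k. k \<in> N)"
  have m: "m \<in> N" "\<And>k. k \<in> N \<Longrightarrow> m \<le> k"
    using False by (auto simp: m_def intro: LeastI Least_le)
  have N: "k = m \<or> k = m + 1" if "k \<in> N" for k
    using m(2) [OF that] assms(3) [OF that m(1)] by linarith
  have mn: "1 \<le> m" "m \<le> n" using m(1) assms(2) by auto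
  show ?thesis
  proof (cases "m < n")
    case True
    then show ?thesis using N mn that [of m] by auto
  next
    \<comment> \<open>If the least member is \<open>n\<close>, the window is shifted down by one to
      stay inside \<open>{1..n}\<close>.\<close>
    case False
    then have "k = m" if "k \<in> N" for k
      using N [OF that] that mn assms(2) by auto
    then have "N \<subseteq> {m - 1, m - 1 + 1}" using mn by auto
    moreover have "m - 1 \<in> {1..<n}" using False mn assms(1) by auto
    ultimately show ?thesis using that by blast
  qed
qed

text \<open>The \<open>Wedge\<close> axioms confine the nonzero coordinates to two neighbours;
  \<open>rho\<close> bounds their sum below by 1, the \<open>Odot\<close> axiom above by 1.\<close>

lemma on_pathI:
  assumes "2 \<le> n" "\<And>k. k \<in> {1..n} \<Longrightarrow> v k \<in> {0..1}" "\<And>a. a \<in> AA n \<Longrightarrow> ev v a = 1"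
  shows "on_path n v"
proof -
  have "\<bar>int j - int k\<bar> \<le> 1"
    if "j \<in> {k \<in> {1..n}. v k \<noteq> 0}" "k \<in> {k \<in> {1..n}. v k \<noteq> 0}" for j k
  proof (rule ccontr)
    assume "\<not> \<bar>int j - int k\<bar> \<le> 1"
    then have "Neg (Wedge (Var j) (Var k)) \<in> AA n"
      using that by (intro Neg_Wedge_in_AA) auto
    then have "ev v (Neg (Wedge (Var j) (Var k))) = 1" by (rule assms(3))
    moreover have "0 < v j" "0 < v k"
      using that assms(2) [of j] assms(2) [of k] by auto
    ultimately show False by (simp add: ev_Wedge)
  qed
  then obtain i where i: "i \<in> {1..<n}" "{k \<in> {1..n}. v k \<noteq> 0} \<subseteq> {i, i + 1}"
    using pairwise_adjacent [OF assms(1), of "{k \<in> {1..n}. v k \<noteq> 0}"] by blast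
  then have zero: "v k = 0" if "k \<in> {1..n}" "k \<noteq> i" "k \<noteq> i + 1" for k
    using that by auto
  have "min 1 (\<Sum>k=1..n. v k) = 1"
    using assms ev_rho [of n v] rho_in_AA by simp
  then have "1 \<le> v i + v (i + 1)"
    using sum_two_terms [OF i(1) zero] by simp
  moreover have "Neg (Odot (Var i) (Var (i + 1))) \<in> AA n"
    using i(1) by (rule Neg_Odot_in_AA)
  then have "v i + v (i + 1) \<le> 1"
    using assms(3) [of "Neg (Odot (Var i) (Var (i + 1)))"] by (simp add: ev_Odot)
  ultimately show ?thesis
    using i(1) zero assms(2) [of i] unfolding on_path_def by (intro bexI [of _ i]) auto
qed

section \<open>The path inside a linear theory\<close>

text \<open>Refuted variables drop out of the sum one by one; the bound records whether the partial
  sum has reached \<open>i\<close> or passed it.\<close>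

lemma (in derivability) rho_le:
  assumes "\<And>k. k \<in> {1..n} \<Longrightarrow> k \<noteq> i \<Longrightarrow> k \<noteq> i + 1 \<Longrightarrow> Var k \<preceq> Bot" "1 \<le> m" "m \<le> n" "1 \<le> i"
  shows "rho m \<preceq> (if m < i then Bot else if m = i then Var i else Oplus (Var i) (Var (i + 1)))"
  using assms(2,3)
proof (induction m rule: nat_induct_at_least)
  case base
  then show ?case
    using assms(1) [of 1] assms(4) by (auto simp: rho_1 le_refl)
next
  case (Suc m)
  have rho: "rho (Suc m) = Oplus (rho m) (Var (Suc m))"
    using Suc.hyps by (rule rho_Suc)
  consider "Suc m < i" | "Suc m = i" | "m = i" | "i < m" by linarith
  then show ?case
  proof cases
    case 1
    then have "Oplus (rho m) (Var (Suc m)) \<preceq> Oplus Bot Bot"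
      using Suc assms(1) [of "Suc m"] by (intro Oplus_mono) auto
    also have "\<dots> \<simeq> Bot" by (rule Oplus_Bot_left)
    finally show ?thesis using 1 rho by simp
  next
    case 2
    then have "Oplus (rho m) (Var (Suc m)) \<preceq> Oplus Bot (Var i)"
      using Suc by (intro Oplus_mono) (auto simp: le_refl)
    also have "\<dots> \<simeq> Var i" by (rule Oplus_Bot_left)
    finally show ?thesis using 2 rho by simp
  next
    case 3
    then show ?thesis
      using Oplus_mono [OF Suc.IH le_refl, of "Var (Suc m)"] Suc.prems rho by simp
  next
    case 4
    let ?x = "Oplus (Var i) (Var (i + 1))"
    have "Oplus (rho m) (Var (Suc m)) \<preceq> Oplus ?x Bot"
      using 4 Suc assms(1) [of "Suc m"] by (intro Oplus_mono) auto
    also have "\<dots> \<simeq> Oplus Bot ?x" by (rule Oplus_commute)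
    also have "\<dots> \<simeq> ?x" by (rule Oplus_Bot_left)
    finally show ?thesis using 4 rho by simp
  qed
qed

text \<open>A linear theory is prime: a provable join lies below the larger of its
  disjuncts.\<close>

lemma (in linear_theory) Neg_Wedge_cases:
  assumes "provable S (Neg (Wedge a b))"
  shows "provable S (Neg a) \<or> provable S (Neg b)"
proof -
  have v: "provable S (Vee (Neg a) (Neg b))"
    using assms le_mp eqvD1 [OF Neg_Neg] unfolding Wedge_def by blast
  from le_linear [of "Neg a" "Neg b"] show ?thesis
  proof
    assume "Neg a \<preceq> Neg b"
    then show ?thesis using le_mp [OF v Vee_least] le_refl by blast
  next
    assume "Neg b \<preceq> Neg a"
    then show ?thesis using le_mp [OF v Vee_least] le_refl by blast
  qed
qed

text \<open>The initial chart, with \<open>m = n = 1\<close>: the argument of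
  \<open>on_pathI\<close> is repeated inside the theory, with refutability of a variable in place of
  the value 0.\<close>

lemma (in linear_theory) linearizable_path:
  assumes "2 \<le> n" "AA n \<subseteq> S"
  shows "linearizable {ev v | v. on_path n v} (Var ` {1..n})"
proof -
  have AA: "provable S a" if "a \<in> AA n" for a
    using that assms(2) provable.assumption by blast
  have "\<bar>int j - int k\<bar> \<le> 1"
    if "j \<in> {k \<in> {1..n}. \<not> provable S (Neg (Var k))}" "k \<in> {k \<in> {1..n}. \<not> provable S (Neg (Var k))}" for j k
  proof (rule ccontr)
    assume "\<not> \<bar>int j - int k\<bar> \<le> 1"
    then have "Neg (Wedge (Var j) (Var k)) \<in> AA n"
      using that by (intro Neg_Wedge_in_AA) auto
    then show False
      using that AA Neg_Wedge_cases by blast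
  qed
  then obtain i where i: "i \<in> {1..<n}" "{k \<in> {1..n}. \<not> provable S (Neg (Var k))} \<subseteq> {i, i + 1}"
    using pairwise_adjacent [OF assms(1), of "{k \<in> {1..n}. \<not> provable S (Neg (Var k))}"] by blast
  let ?p = "Var i" and ?q = "Var (i + 1)"
  have zero: "Var k \<preceq> Bot" if "k \<in> {1..n}" "k \<noteq> i" "k \<noteq> i + 1" for k
  proof -
    have "Var k \<preceq> Neg (Neg (Var k))" by (rule eqvD2 [OF Neg_Neg])
    also have "\<dots> \<simeq> Bot" using i(2) that by (intro Neg_theorem) auto
    finally show ?thesis .
  qed
  have "rho n \<preceq> Oplus ?p ?q"
    using rho_le [of n i n, OF zero] i(1) by auto
  then have sum: "provable S (Oplus ?p ?q)"
    by (rule le_mp [OF AA [OF rho_in_AA]])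
  have "Neg (Odot ?p ?q) \<in> AA n"
    using i(1) by (rule Neg_Odot_in_AA)
  then have orth: "?p \<preceq> Neg ?q"
    unfolding le_def using AA le_mp [OF _ Neg_Neg_le] by (simp add: Odot_def)
  have bot: "Oplus a Bot \<simeq> a" for a
    using Oplus_commute Oplus_Bot_left by (rule eqv_trans)
  have comb: "comb ?p ?q 1 0 \<simeq> ?p" "comb ?p ?q 0 1 \<simeq> ?q" "comb ?p ?q 1 1 \<simeq> Oplus ?p ?q"
    by (simp_all add: bot Oplus_cong eqv_refl)
  have "unit_partition 1 1 ?p ?q"
    using le_mp [OF sum eqvD2 [OF comb(3)]] eqv_le_trans [OF comb(1) orth]
      eqv_le_trans [OF comb(2) le_Neg_swap [OF orth]]
    unfolding unit_partition_def by simp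
  \<comment> \<open>On the real side the chart is the \<open>i\<close>-th edge of the path.\<close>
  define E where "E P Q = ev (\<lambda>k. if k = i then P else if k = i + 1 then Q else 0)" for P Q
  have "chart {ev v | v. on_path n v} 1 1 ?p ?q E"
  proof -
    have "evaluation (E P Q) \<and> E P Q \<in> {ev v | v. on_path n v}" if "(P, Q) \<in> weights 1 1" for P Q
    proof
      show "evaluation (E P Q)"
        unfolding E_def using that by (intro evaluation_ev) (auto simp: weights_def)
      have "on_path n (\<lambda>k. if k = i then P else if k = i + 1 then Q else 0)"
        unfolding on_path_def using i(1) that by (intro bexI [of _ i]) (auto simp: weights_def)
      then show "E P Q \<in> {ev v | v. on_path n v}"
        unfolding E_def by blast
    qed
    then show ?thesis
      using \<open>unit_partition 1 1 ?p ?q\<close> unfolding chart_def by blast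
  qed
  moreover have "\<exists>j l. linear_in 1 1 ?p ?q E (Var k) j l" if "k \<in> {1..n}" for k
  proof -
    consider "k = i" | "k = i + 1" | "k \<noteq> i" "k \<noteq> i + 1" by blast
    then show ?thesis
    proof cases
      case 1
      then have "linear_in 1 1 ?p ?q E (Var k) 1 0"
        using eqv_sym [OF comb(1)] by (auto simp: linear_in_def E_def)
      then show ?thesis by blast
    next
      case 2
      then have "linear_in 1 1 ?p ?q E (Var k) 0 1"
        using eqv_sym [OF comb(2)] by (auto simp: linear_in_def E_def)
      then show ?thesis by blast
    next
      case 3
      then have "linear_in 1 1 ?p ?q E (Var k) 0 0"
        using zero [OF that] by (auto simp: linear_in_def E_def eqv_def Bot_le)
      then show ?thesis by blast
    qed
  qed
  ultimately show ?thesis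
    unfolding linearizable_def by blast
qed

lemma linearizable_subset:
  "derivability.linearizable S M L \<Longrightarrow> L' \<subseteq> L \<Longrightarrow> derivability.linearizable S M L'"
  unfolding derivability.linearizable_def by blast

theorem completeness_AA:
  assumes "2 \<le> n" "a \<in> formulas n" "\<And>v. on_path n v \<Longrightarrow> ev v a = 1"
  shows "provable (AA n) a"
proof (rule ccontr)
  assume "\<not> provable (AA n) a"
  then obtain T where T: "AA n \<subseteq> T" "\<not> provable T a" "linear_theory T"
    by (rule linear_extension)
  interpret linear_theory T by (rule T(3))
  have "linearizable {ev v | v. on_path n v} (insert a (Var ` {1..n}))"
    using linearizable_path [OF assms(1) T(1)] assms(2)
    by (intro linearizable_formula) (auto simp: formulas_def)
  then have "linearizable {ev v | v. on_path n v} {a}"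
    by (rule linearizable_subset) simp
  then show False
    using T(2) assms(3) by (auto elim: linearizable_countermodel)
qed

lemma ev_cong: "(\<And>i. i \<in> vars a \<Longrightarrow> v i = w i) \<Longrightarrow> ev v a = ev w a"
  by (induction a) auto

lemma Theta_iff:
  assumes "\<And>i x. i \<in> {1..n} \<Longrightarrow> x \<in> {0..1} \<Longrightarrow> f i x \<in> {0..1}"
  shows "a \<in> Theta n f \<longleftrightarrow> a \<in> formulas n \<and> (\<forall>x\<in>{0..1}. ev (\<lambda>i. f i x) a = 1)"
proof (intro iffI conjI ballI)
  assume a: "a \<in> Theta n f"
  then show fm: "a \<in> formulas n" by (simp add: Theta_def)
  fix x :: real assume x: "x \<in> {0..1}"
  \<comment> \<open>Indices outside \<open>{1..n}\<close> are set to 0, because \<open>f\<close> may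
    leave \<open>[0,1]\<close> there while an evaluation may not.\<close>
  define v where "v i = (if i \<in> {1..n} then f i x else 0)" for i
  have "evaluation (ev v)"
    using assms x by (intro evaluation_ev) (auto simp: v_def)
  moreover have "\<forall>i\<in>{1..n}. ev v (Var i) = f i x" by (simp add: v_def)
  ultimately have "ev v a = 1"
    using a x unfolding Theta_def by blast
  moreover have "ev v a = ev (\<lambda>i. f i x) a"
    using fm by (intro ev_cong) (auto simp: v_def formulas_def)
  ultimately show "ev (\<lambda>i. f i x) a = 1" by simp
next
  assume a: "a \<in> formulas n \<and> (\<forall>x\<in>{0..1}. ev (\<lambda>i. f i x) a = 1)"
  have "\<mu> a = 1" if \<mu>: "evaluation \<mu>" and x: "x \<in> {0..1}" "\<forall>i\<in>{1..n}. \<mu> (Var i) = f i x" for \<mu> x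
  proof -
    have "\<mu> a = ev (\<lambda>i. f i x) a"
      using a x(2) by (intro evaluation_eqI [OF \<mu>]) (auto simp: formulas_def)
    then show ?thesis using a x(1) by simp
  qed
  then show "a \<in> Theta n f" using a by (auto simp: Theta_def)
qed

lemma soundness_AA:
  assumes "provable (AA n) a" "a \<in> formulas n" "on_path n v"
  shows "ev v a = 1"
proof -
  \<comment> \<open>\<open>on_path\<close> says nothing about coordinates outside
    \<open>{1..n}\<close>, whereas \<open>soundness\<close> needs all of them in
    \<open>[0,1]\<close>.\<close>
  define w where "w i = (if i \<in> {1..n} then v i else 0)" for i
  have "on_path n w"
    using assms(3) by (rule on_path_cong) (auto simp: w_def)
  then have "ev w a = 1"
    using assms(1) ev_AA on_path_mem [OF assms(3)]
    by (intro soundness [of "AA n" a w]) (auto simp: w_def)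
  moreover have "ev w a = ev v a"
    using assms(2) by (intro ev_cong) (auto simp: w_def formulas_def)
  ultimately show ?thesis by simp
qed

section \<open>Position along the path\<close>

text \<open>A coordinate on the path: it is \<open>j\<close> at the vertex \<open>e\<^sub>j\<close>
  and affine along each edge.\<close>

definition position :: "nat \<Rightarrow> (nat \<Rightarrow> real) \<Rightarrow> real" where
  "position n v = (\<Sum>k=1..n. real k * v k)"

lemma on_path_position:
  assumes "on_path n v"
  obtains i where "i \<in> {1..<n}" "v i = real i + 1 - position n v" "v (i + 1) = position n v - real i"
    "\<And>k. k \<in> {1..n} \<Longrightarrow> k \<noteq> i \<Longrightarrow> k \<noteq> i + 1 \<Longrightarrow> v k = 0"
    "real i \<le> position n v" "position n v \<le> real i + 1"
proof -
  obtain i where i: "i \<in> {1..<n}" "v i \<in> {0..1}" "v (i + 1) = 1 - v i"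
    and zero: "\<And>k. k \<in> {1..n} \<Longrightarrow> k \<noteq> i \<Longrightarrow> k \<noteq> i + 1 \<Longrightarrow> v k = 0"
    using assms unfolding on_path_def by blast
  have "position n v = real i * v i + real (i + 1) * v (i + 1)"
    unfolding position_def using i(1) zero by (intro sum_two_terms) auto
  also have "\<dots> = real i + 1 - v i" unfolding i(3) by (simp add: algebra_simps)
  finally show ?thesis using that [OF i(1) _ _ zero] i by auto
qed

text \<open>The edge \<open>j\<close> obtained for the point differs from the prescribed
  \<open>i\<close> only at a common vertex, where both descriptions agree.\<close>

lemma on_path_at_position:
  assumes "on_path n v" "i \<in> {1..<n}" "real i \<le> position n v" "position n v \<le> real i + 1"
  shows "v i = real i + 1 - position n v" "v (i + 1) = position n v - real i"
    "\<And>k. k \<in> {1..n} \<Longrightarrow> k \<noteq> i \<Longrightarrow> k \<noteq> i + 1 \<Longrightarrow> v k = 0"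
proof -
  obtain j where j: "j \<in> {1..<n}" "v j = real j + 1 - position n v" "v (j + 1) = position n v - real j"
    "\<And>k. k \<in> {1..n} \<Longrightarrow> k \<noteq> j \<Longrightarrow> k \<noteq> j + 1 \<Longrightarrow> v k = 0"
    "real j \<le> position n v" "position n v \<le> real j + 1"
    using on_path_position [OF assms(1)] by blast
  consider "j = i" | "j + 1 = i" "position n v = real i" | "j = i + 1" "position n v = real j"
    using j(5,6) assms(3,4) by linarith
  then have "v i = real i + 1 - position n v \<and> v (i + 1) = position n v - real i \<and>
    (\<forall>k\<in>{1..n}. k \<noteq> i \<longrightarrow> k \<noteq> i + 1 \<longrightarrow> v k = 0)"
  proof cases
    case 1
    then show ?thesis using j by auto
  next
    case 2
    have "v k = 0" if "k \<in> {1..n}" "k \<noteq> i" for k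
      using that j(2,4) 2 by (cases "k = j") auto
    then show ?thesis using j(3) 2 assms(2) by auto
  next
    case 3
    have "v k = 0" if "k \<in> {1..n}" "k \<noteq> j" for k
      using that j(3,4) 3 by (cases "k = j + 1") auto
    then show ?thesis using j(2) 3 assms(2) by auto
  qed
  then show "v i = real i + 1 - position n v" "v (i + 1) = position n v - real i"
    "\<And>k. k \<in> {1..n} \<Longrightarrow> k \<noteq> i \<Longrightarrow> k \<noteq> i + 1 \<Longrightarrow> v k = 0"
    by auto
qed

lemma on_path_determined:
  assumes "on_path n v" "on_path n w" "position n v = position n w" "k \<in> {1..n}"
  shows "v k = w k"
proof -
  obtain i where i: "i \<in> {1..<n}" "real i \<le> position n v" "position n v \<le> real i + 1"
    using on_path_position [OF assms(1)] by blast
  note v = on_path_at_position [OF assms(1) i]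
    and w = on_path_at_position [OF assms(2) i [unfolded assms(3)]]
  show ?thesis
    using v(1,2) w(1,2) v(3) [OF assms(4)] w(3) [OF assms(4)] unfolding assms(3)
    by (cases "k = i"; cases "k = i + 1") simp_all
qed

lemma position_vertex:
  assumes "on_path n v" "j \<in> {1..n}" "v j = 1"
  shows "position n v = real j"
proof -
  obtain i where i: "i \<in> {1..<n}" "v i = real i + 1 - position n v" "v (i + 1) = position n v - real i"
    "\<And>k. k \<in> {1..n} \<Longrightarrow> k \<noteq> i \<Longrightarrow> k \<noteq> i + 1 \<Longrightarrow> v k = 0"
    using on_path_position [OF assms(1)] by blast
  then show ?thesis
    using assms(2,3) by (cases "j = i"; cases "j = i + 1") auto
qed

lemma position_bounds:
  assumes "on_path n v"
  shows "1 \<le> position n v" "position n v \<le> real n"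
proof -
  obtain i where "i \<in> {1..<n}" "real i \<le> position n v" "position n v \<le> real i + 1"
    using on_path_position [OF assms] by blast
  then show "1 \<le> position n v" "position n v \<le> real n" by auto
qed

lemma on_path_reverse:
  assumes "on_path n v"
  shows "on_path n (\<lambda>k. v (n + 1 - k))" "position n (\<lambda>k. v (n + 1 - k)) = real n + 1 - position n v"
proof -
  obtain i where i: "i \<in> {1..<n}" "v i \<in> {0..1}" "v (i + 1) = 1 - v i"
    and zero: "\<And>k. k \<in> {1..n} \<Longrightarrow> k \<noteq> i \<Longrightarrow> k \<noteq> i + 1 \<Longrightarrow> v k = 0"
    using assms unfolding on_path_def by blast
  have ni: "n + 1 - (n - i) = i + 1" "n + 1 - (n - i + 1) = i" "n - i \<in> {1..<n}"
    using i(1) by auto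
  have "v (n + 1 - k) = 0" if "k \<in> {1..n}" "k \<noteq> n - i" "k \<noteq> n - i + 1" for k
    using that i(1) by (intro zero) auto
  then show "on_path n (\<lambda>k. v (n + 1 - k))"
    unfolding on_path_def using i ni by (intro bexI [of _ "n - i"]) auto
  \<comment> \<open>As the coordinates sum to 1, the reflected weights \<open>n + 1 - k\<close>
    yield \<open>n + 1\<close> minus the position.\<close>
  have total: "(\<Sum>k=1..n. v k) = 1"
  proof -
    have "(\<Sum>k=1..n. v k) = v i + v (i + 1)" using i(1) zero by (rule sum_two_terms)
    then show ?thesis using i(3) by linarith
  qed
  have "position n (\<lambda>k. v (n + 1 - k)) = (\<Sum>k=1..n. real (n + 1 - k) * v k)"
    unfolding position_def by (subst sum.atLeastAtMost_rev) (auto intro: sum.cong)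
  also have "\<dots> = (\<Sum>k=1..n. (real n + 1) * v k - real k * v k)"
    by (intro sum.cong) (auto simp: of_nat_diff algebra_simps)
  also have "\<dots> = real n + 1 - position n v"
    by (simp add: position_def sum_subtractf sum_distrib_left [symmetric] total [unfolded One_nat_def])
  finally show "position n (\<lambda>k. v (n + 1 - k)) = real n + 1 - position n v" .
qed

section \<open>Pseudo-triangular bases\<close>

text \<open>The nodes cut \<open>[0,1]\<close> into intervals, each mapped bijectively onto one
  edge, so the image of \<open>g\<close> is the whole path and validity on it is derivability from
  \<open>AA n\<close>.\<close>

lemma ordered_basis_Theta:
  assumes "ordered_pseudo_triangular_basis n g"
    and g: "\<And>i x. i \<in> {1..n} \<Longrightarrow> x \<in> {0..1} \<Longrightarrow> g i x \<in> {0..1}"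
    and "n > 0"
  shows "Theta n g = consequences n (AA n)" "separating n g"
proof -
  obtain t where t: "t 1 = 0" "t n = 1" "\<And>i. i \<in> {1..<n} \<Longrightarrow> t i < t (i + 1)"
    and basis: "\<And>i. i \<in> {1..<n} \<Longrightarrow> g i (t i) = 1 \<and> g i (t (i + 1)) = 0 \<and>
      (\<forall>j\<in>{1..n}. j \<noteq> i \<longrightarrow> j \<noteq> i + 1 \<longrightarrow> (\<forall>x\<in>{t i..t (i + 1)}. g j x = 0)) \<and>
      (\<forall>x\<in>{t i..t (i + 1)}. g (i + 1) x = 1 - g i x) \<and>
      bij_betw (g i) {t i..t (i + 1)} {0..1}"
    using assms(1) unfolding ordered_pseudo_triangular_basis_def by blast
  have n: "2 \<le> n"
    using t(1,2) assms(3) by (cases "n = 1") auto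
  have t_mono: "t i \<le> t j" if "i \<le> j" "1 \<le> i" "j \<le> n" for i j
    using that
  proof (induction j rule: dec_induct)
    case (step j)
    then show ?case using t(3) [of j] by fastforce
  qed simp
  have unit: "x \<in> {0..1}" if "i \<in> {1..<n}" "x \<in> {t i..t (i + 1)}" for i x
    using that t_mono [of 1 i] t_mono [of "i + 1" n] t(1,2) by auto
  have path: "on_path n (\<lambda>k. g k x)" if i: "i \<in> {1..<n}" and x: "x \<in> {t i..t (i + 1)}" for i x
    unfolding on_path_def using basis [OF i] x g [of i x] unit [OF i x] i by (intro bexI [of _ i]) auto
  have "x \<le> t m \<longrightarrow> (\<exists>i\<in>{1..<m}. x \<in> {t i..t (i + 1)})" if "2 \<le> m" "0 \<le> x" for m x
    using that(1)
  proof (induction m rule: nat_induct_at_least)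
    case base
    then show ?case using that(2) t(1) by (auto simp: numeral_2_eq_2)
  next
    case (Suc m)
    show ?case
    proof
      assume "x \<le> t (Suc m)"
      then consider "x \<le> t m" | "x \<in> {t m..t (m + 1)}" by fastforce
      then show "\<exists>i\<in>{1..<Suc m}. x \<in> {t i..t (i + 1)}"
        using Suc by cases (fastforce, intro bexI [of _ m], auto)
    qed
  qed
  then have cover: "\<exists>i\<in>{1..<n}. x \<in> {t i..t (i + 1)}" if "x \<in> {0..1}" for x
    using that n t(2) by auto
  show "Theta n g = consequences n (AA n)"
  proof (intro equalityI subsetI)
    fix a assume "a \<in> Theta n g"
    then have a: "a \<in> formulas n" "\<And>x. x \<in> {0..1} \<Longrightarrow> ev (\<lambda>k. g k x) a = 1"
      using Theta_iff [of n g] g by auto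
    have "ev v a = 1" if v: "on_path n v" for v
    proof -
      obtain i where i: "i \<in> {1..<n}" "v i \<in> {0..1}" "v (i + 1) = 1 - v i"
        and zero: "\<And>k. k \<in> {1..n} \<Longrightarrow> k \<noteq> i \<Longrightarrow> k \<noteq> i + 1 \<Longrightarrow> v k = 0"
        using v unfolding on_path_def by blast
      \<comment> \<open>The value \<open>v i\<close> is attained on the node interval; the remaining
        coordinates are then forced.\<close>
      have "v i \<in> g i ` {t i..t (i + 1)}"
        using basis [OF i(1)] i(2) by (simp add: bij_betw_def)
      then obtain x where x: "x \<in> {t i..t (i + 1)}" "v i = g i x" by blast
      have "v k = g k x" if "k \<in> {1..n}" for k
        using basis [OF i(1)] x i(3) zero [of k] that by (cases "k = i"; cases "k = i + 1") auto
      then have "ev v a = ev (\<lambda>k. g k x) a"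
        using a(1) by (intro ev_cong) (auto simp: formulas_def)
      then show ?thesis using a(2) [OF unit [OF i(1) x(1)]] by simp
    qed
    then show "a \<in> consequences n (AA n)"
      using completeness_AA [OF n a(1)] a(1) by (simp add: consequences_def)
  next
    fix a assume "a \<in> consequences n (AA n)"
    then have a: "a \<in> formulas n" "provable (AA n) a" by (auto simp: consequences_def)
    have "ev (\<lambda>k. g k x) a = 1" if "x \<in> {0..1}" for x
      using cover [OF that] path soundness_AA [OF a(2,1)] by blast
    then show "a \<in> Theta n g"
      using Theta_iff [of n g] g a(1) by auto
  qed
  \<comment> \<open>Within one interval injectivity suffices; for adjacent intervals
    \<open>g i\<close> vanishes at both points, so \<open>x\<close> is the common node; for distant
    ones \<open>g i\<close> and \<open>g (i + 1)\<close> vanish at \<open>y\<close> yet sum to 1 at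
    \<open>x\<close>.\<close>
  have eq: "x = y"
    if ij: "i \<in> {1..<n}" "x \<in> {t i..t (i + 1)}" "j \<in> {1..<n}" "y \<in> {t j..t (j + 1)}" "i \<le> j"
      and same: "\<And>k. k \<in> {1..n} \<Longrightarrow> g k x = g k y" for x y i j
  proof -
    have inj: "u = w" if "k \<in> {1..<n}" "u \<in> {t k..t (k + 1)}" "w \<in> {t k..t (k + 1)}" "g k u = g k w" for k u w
      using basis [OF that(1)] that(2-4) by (auto simp: bij_betw_def dest: inj_onD)
    have one: "g (i + 1) x = 1 - g i x" using basis [OF ij(1)] ij(2) by blast
    consider "j = i" | "j = i + 1" | "i + 1 < j" using ij(5) by linarith
    then show ?thesis
    proof cases
      case 1
      then show ?thesis using inj [OF ij(1,2)] ij same [of i] by auto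
    next
      case 2
      then have "g i y = 0" using basis [OF ij(3)] ij(1,4) by auto
      then have "g i x = g i (t (i + 1))" using basis [OF ij(1)] same [of i] ij(1) by auto
      then have "x = t j" using inj [OF ij(1,2), of "t (i + 1)"] t(3) [OF ij(1)] 2 by auto
      then have "x \<in> {t j..t (j + 1)}" using t(3) [OF ij(3)] by auto
      then show ?thesis using inj [OF ij(3) _ ij(4)] same [of j] ij(3) by auto
    next
      case 3
      then have "g i y = 0" "g (i + 1) y = 0" using basis [OF ij(3)] ij(1,4) by auto
      then show ?thesis using one same [of i] same [of "i + 1"] ij(1) by auto
    qed
  qed
  show "separating n g"
    unfolding separating_def
  proof (intro ballI impI, rule ccontr)
    fix x y :: real assume xy: "x \<in> {0..1}" "y \<in> {0..1}" "x \<noteq> y" "\<not> (\<exists>i\<in>{1..n}. g i x \<noteq> g i y)"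
    then have same: "\<And>k. k \<in> {1..n} \<Longrightarrow> g k x = g k y" by blast
    obtain i j where ij: "i \<in> {1..<n}" "x \<in> {t i..t (i + 1)}" "j \<in> {1..<n}" "y \<in> {t j..t (j + 1)}"
      using cover xy(1,2) by blast
    show False
    proof (cases "i \<le> j")
      case True
      then show ?thesis using eq [OF ij True same] xy(3) by blast
    next
      case False
      then have "j \<le> i" by simp
      then show ?thesis using eq [OF ij(3,4,1,2) \<open>j \<le> i\<close> same [symmetric]] xy(3) by blast
    qed
  qed
qed

text \<open>If \<open>g j\<close> stays below some \<open>M < 1\<close>, then a large multiple of \<open>\<not>X\<^sub>j\<close> is valid on the image
  of \<open>g\<close>, but it fails at the vertex \<open>e\<^sub>j\<close> of the path.\<close>

lemma Theta_vertex:
  assumes "Theta n g = consequences n (AA n)" "2 \<le> n" "j \<in> {1..n}"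
    and cont: "continuous_on {0..1} (g j)"
    and g: "\<And>i x. i \<in> {1..n} \<Longrightarrow> x \<in> {0..1} \<Longrightarrow> g i x \<in> {0..1}"
  shows "\<exists>x\<in>{0..1}. g j x = 1"
proof (rule ccontr)
  assume none: "\<not> ?thesis"
  obtain x0 where x0: "x0 \<in> {0..1}" "\<And>x. x \<in> {0..1} \<Longrightarrow> g j x \<le> g j x0"
    using continuous_attains_sup [OF _ _ cont] by auto
  then have "g j x0 < 1"
    using none g [OF assms(3) x0(1)] by force
  \<comment> \<open>\<open>g j x0\<close> is the maximum and below 1, so \<open>k\<close> copies of
    \<open>Neg (Var j)\<close> sum to at least 1 on the whole image.\<close>
  obtain k :: nat where "1 / (1 - g j x0) < real k"
    using reals_Archimedean2 by blast
  then have k: "1 < real k * (1 - g j x0)"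
    using \<open>g j x0 < 1\<close> by (simp add: field_simps)
  define a where "a = comb (Neg (Var j)) Bot k 0"
  have ev: "ev v a = min 1 (real k * (1 - v j))" if "v j \<le> 1" for v
    unfolding a_def using that by (induction k) (auto simp: algebra_simps min_def)
  have "vars a \<subseteq> {j}"
    unfolding a_def by (induction k) (auto simp: Oplus_def)
  then have a: "a \<in> formulas n"
    using assms(3) by (auto simp: formulas_def)
  have "ev (\<lambda>i. g i x) a = 1" if "x \<in> {0..1}" for x
  proof -
    have "real k * (1 - g j x0) \<le> real k * (1 - g j x)"
      using x0(2) [OF that] by (intro mult_left_mono) auto
    then show ?thesis using ev [of "\<lambda>i. g i x"] g [OF assms(3) that] k by auto
  qed
  then have "a \<in> consequences n (AA n)"
    using Theta_iff [of n g] g a assms(1) by auto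
  moreover have "on_path n (\<lambda>i. if i = j then 1 else 0)"
  proof (cases "j < n")
    case True
    then show ?thesis using assms(3) unfolding on_path_def by (intro bexI [of _ j]) auto
  next
    \<comment> \<open>The vertex \<open>e\<^sub>n\<close> starts no edge, so it is taken as the end
      of the last one.\<close>
    case False
    then show ?thesis using assms(2,3) unfolding on_path_def by (intro bexI [of _ "n - 1"]) auto
  qed
  ultimately show False
    using soundness_AA [of n a "\<lambda>i. if i = j then 1 else 0"] ev by (simp add: consequences_def)
qed

section \<open>Recovering the basis from the path\<close>

text \<open>The nodes are the parameters where the curve meets the vertices. The position is
  \<open>j\<close> at \<open>t j\<close>, so monotonicity orders the nodes and confines the curve to
  edge \<open>i\<close> between \<open>t i\<close> and \<open>t (i + 1)\<close>.\<close>

lemma ordered_basisI: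
  assumes "2 \<le> n"
    and cont: "\<And>i. i \<in> {1..n} \<Longrightarrow> continuous_on {0..1} (g i)"
    and path: "\<And>x. x \<in> {0..1} \<Longrightarrow> on_path n (\<lambda>k. g k x)"
    and vertex: "\<And>j. j \<in> {1..n} \<Longrightarrow> \<exists>x\<in>{0..1}. g j x = 1"
    and mono: "strict_mono_on {0..1} (\<lambda>x. position n (\<lambda>k. g k x))"
  shows "ordered_pseudo_triangular_basis n g"
proof -
  define h where "h x = position n (\<lambda>k. g k x)" for x
  note less_iff = strict_mono_on_less [OF mono, folded h_def]
    and le_iff = strict_mono_on_less_eq [OF mono, folded h_def]
  obtain t where t: "\<And>j. j \<in> {1..n} \<Longrightarrow> t j \<in> {0..1} \<and> g j (t j) = 1"
    using vertex by metis
  have ht: "h (t j) = real j" if "j \<in> {1..n}" for j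
    unfolding h_def using t [OF that] by (intro position_vertex path) (use that in auto)
  have h: "1 \<le> h x" "h x \<le> real n" if "x \<in> {0..1}" for x
    unfolding h_def using position_bounds path [OF that] by auto
  have ends: "t 1 \<in> {0..1}" "t n \<in> {0..1}" "h (t 1) = 1" "h (t n) = real n"
    using t [of 1] t [of n] ht [of 1] ht [of n] assms(1) by auto
  \<comment> \<open>Vertices 1 and \<open>n\<close> have extremal positions, so their parameters
    must be the ends of \<open>[0,1]\<close>.\<close>
  have "t 1 = 0"
    using le_iff [OF ends(1), of 0] h(1) [of 0] ends by auto
  moreover have "t n = 1"
    using le_iff [OF _ ends(2), of 1] h(2) [of 1] ends by auto
  moreover have t_less: "t i < t (i + 1)" if "i \<in> {1..<n}" for i
    using less_iff [of "t i" "t (i + 1)"] t [of i] t [of "i + 1"] ht [of i] ht [of "i + 1"] that by auto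
  moreover have "g i (t i) = 1 \<and> g i (t (i + 1)) = 0 \<and>
          (\<forall>j\<in>{1..n}. j \<noteq> i \<longrightarrow> j \<noteq> i + 1 \<longrightarrow> (\<forall>x\<in>{t i..t (i + 1)}. g j x = 0)) \<and>
          (\<forall>x\<in>{t i..t (i + 1)}. g (i + 1) x = 1 - g i x) \<and>
          bij_betw (g i) {t i..t (i + 1)} {0..1} \<and>
          bij_betw (g (i + 1)) {t i..t (i + 1)} {0..1}" if i: "i \<in> {1..<n}" for i
  proof -
    let ?I = "{t i..t (i + 1)}"
    have ti: "t i \<in> {0..1}" "t (i + 1) \<in> {0..1}" "g i (t i) = 1" "h (t i) = real i" "h (t (i + 1)) = real i + 1"
      using t [of i] t [of "i + 1"] ht [of i] ht [of "i + 1"] i by auto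
    have sub: "?I \<subseteq> {0..1}" using ti by auto
    have g: "g i x = real i + 1 - h x" "g (i + 1) x = h x - real i"
      "\<And>k. k \<in> {1..n} \<Longrightarrow> k \<noteq> i \<Longrightarrow> k \<noteq> i + 1 \<Longrightarrow> g k x = 0" "real i \<le> h x" "h x \<le> real i + 1"
      if "x \<in> ?I" for x
    proof -
      have x: "x \<in> {0..1}" using that sub by blast
      show hx: "real i \<le> h x" "h x \<le> real i + 1"
        using le_iff [OF ti(1) x] le_iff [OF x ti(2)] that ti by auto
      show "g i x = real i + 1 - h x" "g (i + 1) x = h x - real i"
        "\<And>k. k \<in> {1..n} \<Longrightarrow> k \<noteq> i \<Longrightarrow> k \<noteq> i + 1 \<Longrightarrow> g k x = 0"
        using on_path_at_position [OF path [OF x] i hx [unfolded h_def]] unfolding h_def by blast+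
    qed
    have mem: "t i \<in> ?I" "t (i + 1) \<in> ?I" using t_less [OF i] by auto
    have zero: "g i (t (i + 1)) = 0" using g(1) [OF mem(2)] ti(5) by simp
    have "inj_on h {0..1}"
      using mono unfolding h_def [symmetric] by (rule strict_mono_on_imp_inj_on)
    have "inj_on (g i) ?I"
    proof (intro inj_onI)
      fix x y assume "x \<in> ?I" "y \<in> ?I" "g i x = g i y"
      then have "h x = h y" "x \<in> {0..1}" "y \<in> {0..1}"
        using g(1) [of x] g(1) [of y] sub by (simp_all add: subset_iff)
      then show "x = y"
        by (rule inj_onD [OF \<open>inj_on h {0..1}\<close>])
    qed
    moreover have "g i ` ?I = {0..1}"
    proof (intro equalityI subsetI)
      fix y :: real assume "y \<in> {0..1}"
      \<comment> \<open>\<open>g i\<close> starts at 1 and ends at 0, so the intermediate value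
        theorem applies.\<close>
      then have "\<exists>x\<ge>t i. x \<le> t (i + 1) \<and> g i x = y"
        using ti(3) zero t_less [OF i] i continuous_on_subset [OF cont [of i] sub]
        by (intro IVT2') auto
      then show "y \<in> g i ` ?I" by auto
    qed (use g(1,4,5) in auto)
    ultimately have bij: "bij_betw (g i) ?I {0..1}" by (simp add: bij_betw_def)
    \<comment> \<open>\<open>g (i + 1)\<close> is \<open>g i\<close> followed by this
      reflection.\<close>
    have "bij_betw (\<lambda>y::real. 1 - y) {0..1} {0..1}"
      by (rule bij_betwI [where g = "\<lambda>y. 1 - y"]) auto
    from bij_betw_trans [OF bij this] have "bij_betw (g (i + 1)) ?I {0..1}"
      using bij_betw_cong [of ?I "(\<lambda>y. 1 - y) \<circ> g i" "g (i + 1)"] g(1,2) by simp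
    then show ?thesis using bij zero ti(3) g by auto
  qed
  ultimately show ?thesis
    unfolding ordered_pseudo_triangular_basis_def by blast
qed

lemma Theta_basis:
  assumes "n > 0" "Theta n g = consequences n (AA n)" "separating n g"
    and cont: "\<And>i. i \<in> {1..n} \<Longrightarrow> continuous_on {0..1} (g i)"
    and g: "\<And>i x. i \<in> {1..n} \<Longrightarrow> x \<in> {0..1} \<Longrightarrow> g i x \<in> {0..1}"
  shows "pseudo_triangular_basis n g"
proof -
  have AA: "ev (\<lambda>k. g k x) a = 1" if "a \<in> AA n" "x \<in> {0..1}" for a x
  proof -
    have "a \<in> Theta n g"
      using that(1) assms(1,2) AA_subset_formulas [of n] provable.assumption
      by (auto simp: consequences_def)
    then show ?thesis using Theta_iff [of n g] g that(2) by auto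
  qed
  \<comment> \<open>For \<open>n = 1\<close> the axiom \<open>rho\<close> is the variable itself, so
    \<open>g 1\<close> would be constantly 1 and could not separate 0 from 1.\<close>
  have n: "2 \<le> n"
  proof (rule ccontr)
    assume "\<not> 2 \<le> n"
    then have "n = 1" using assms(1) by simp
    then have "g 1 x = 1" if "x \<in> {0..1}" for x
      using AA [OF rho_in_AA that] by (simp add: rho_1)
    then show False
      using assms(3) \<open>n = 1\<close> by (simp add: separating_def) (metis atLeastAtMost_iff order_refl zero_le_one zero_neq_one)
  qed
  have path: "on_path n (\<lambda>k. g k x)" if "x \<in> {0..1}" for x
    using n g [OF _ that] AA [OF _ that] by (intro on_pathI) auto
  have vertex: "\<exists>x\<in>{0..1}. g j x = 1" if "j \<in> {1..n}" for j
    using assms(2) n that cont [OF that] g by (rule Theta_vertex)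
  define h where "h x = position n (\<lambda>k. g k x)" for x
  have "continuous_on {0..1} h"
    unfolding h_def position_def using cont by (intro continuous_intros) auto
  moreover have "inj_on h {0..1}"
  proof (rule inj_onI, rule ccontr)
    fix x y assume xy: "x \<in> {0..1}" "y \<in> {0..1}" "h x = h y" "x \<noteq> y"
    have "g k x = g k y" if "k \<in> {1..n}" for k
      using on_path_determined [OF path [OF xy(1)] path [OF xy(2)] _ that] xy(3) by (simp add: h_def)
    then show False using xy assms(3) unfolding separating_def by blast
  qed
  ultimately have "strict_mono_on {0..1} h \<or> strict_antimono_on {0..1} h"
    using injective_eq_monotone_map is_interval_cc by blast
  then show ?thesis
  proof
    assume "strict_mono_on {0..1} h"
    then have "ordered_pseudo_triangular_basis n g"
      using n cont path vertex unfolding h_def by (intro ordered_basisI) auto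
    then show ?thesis
      unfolding pseudo_triangular_basis_def by (intro exI [of _ id]) (simp add: permutes_id)
  next
    assume anti: "strict_antimono_on {0..1} h"
    \<comment> \<open>The reversal of \<open>{1..n}\<close>, extended by the identity to a
      permutation; it turns the position \<open>h x\<close> into \<open>n + 1 - h x\<close>, which
      increases.\<close>
    define r where "r k = (if k \<in> {1..n} then n + 1 - k else k)" for k
    have r: "r permutes {1..n}"
      by (rule bij_imp_permutes) (auto simp: r_def intro!: bij_betwI [where g = r])
    have path': "on_path n (\<lambda>k. g (r k) x) \<and> position n (\<lambda>k. g (r k) x) = real n + 1 - h x"
      if "x \<in> {0..1}" for x
    proof
      have eq: "g (r k) x = g (n + 1 - k) x" if "k \<in> {1..n}" for k
        using that by (simp add: r_def)
      show "on_path n (\<lambda>k. g (r k) x)"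
        using on_path_reverse(1) [OF path [OF that]] eq by (rule on_path_cong)
      have "position n (\<lambda>k. g (r k) x) = position n (\<lambda>k. g (n + 1 - k) x)"
        unfolding position_def using eq by (intro sum.cong) auto
      then show "position n (\<lambda>k. g (r k) x) = real n + 1 - h x"
        using on_path_reverse(2) [OF path [OF that]] by (simp add: h_def)
    qed
    have r_mem: "r k \<in> {1..n}" if "k \<in> {1..n}" for k
      using that permutes_in_image [OF r] by blast
    have "strict_mono_on {0..1} (\<lambda>x. position n (\<lambda>k. (g \<circ> r) k x))"
      using anti path' by (auto simp: monotone_on_def)
    then have "ordered_pseudo_triangular_basis n (g \<circ> r)"
      using n cont path' vertex r_mem by (intro ordered_basisI) auto
    then show ?thesis
      unfolding pseudo_triangular_basis_def using r by blast
  qed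
qed

section \<open>Renumbering and the equivalence\<close>

lemma separating_permute:
  assumes "\<sigma> permutes {1..n}"
  shows "separating n (f \<circ> \<sigma>) \<longleftrightarrow> separating n f"
proof -
  have "(\<exists>i\<in>{1..n}. f (\<sigma> i) x \<noteq> f (\<sigma> i) y) \<longleftrightarrow> (\<exists>i\<in>\<sigma> ` {1..n}. f i x \<noteq> f i y)" for x y
    by blast
  then show ?thesis
    unfolding separating_def permutes_image [OF assms] by simp
qed

lemma pseudo_triangular_basis_permute:
  assumes "\<sigma> permutes {1..n}" "pseudo_triangular_basis n (f \<circ> \<sigma>)"
  shows "pseudo_triangular_basis n f"
  using assms permutes_compose unfolding pseudo_triangular_basis_def comp_assoc by blast

theorem mainTheorem4:
  fixes n :: nat and f :: "nat \<Rightarrow> real \<Rightarrow> real"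
  assumes "n > 0"
    and "\<And>i. i \<in> {1..n} \<Longrightarrow> continuous_on {0..1} (f i)"
    and "\<And>i. i \<in> {1..n} \<Longrightarrow> f i \<in> {0..1} \<rightarrow> {0..1}"
  shows "(pseudo_triangular_basis n f \<longleftrightarrow>
            separating n f \<and>
            (\<exists>\<sigma>. \<sigma> permutes {1..n} \<and> Theta n (f \<circ> \<sigma>) = consequences n (AA n)))
         \<and> (ordered_pseudo_triangular_basis n f \<longrightarrow> Theta n f = consequences n (AA n))"
proof (intro conjI iffI impI)
  \<comment> \<open>Every renumbering inherits range and continuity, so the results for ordered
    families apply to \<open>f \<circ> \<sigma>\<close>; separation and being a basis do not depend
    on the numbering.\<close>
  have range: "(f \<circ> \<sigma>) i x \<in> {0..1}" if "\<sigma> permutes {1..n}" "i \<in> {1..n}" "x \<in> {0..1}" for \<sigma> i x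
    using assms(3) [of "\<sigma> i"] permutes_in_image [OF that(1)] that(2,3) by auto
  have cont: "continuous_on {0..1} ((f \<circ> \<sigma>) i)" if "\<sigma> permutes {1..n}" "i \<in> {1..n}" for \<sigma> i
    using assms(2) [of "\<sigma> i"] permutes_in_image [OF that(1)] that(2) by simp
  {
    assume "pseudo_triangular_basis n f"
    then obtain \<sigma> where \<sigma>: "\<sigma> permutes {1..n}" "ordered_pseudo_triangular_basis n (f \<circ> \<sigma>)"
      unfolding pseudo_triangular_basis_def by blast
    note * = ordered_basis_Theta [OF \<sigma>(2) range [OF \<sigma>(1)] assms(1)]
    show "separating n f"
      using *(2) separating_permute [OF \<sigma>(1)] by blast
    show "\<exists>\<sigma>. \<sigma> permutes {1..n} \<and> Theta n (f \<circ> \<sigma>) = consequences n (AA n)"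
      using *(1) \<sigma>(1) by blast
  next
    assume "separating n f \<and> (\<exists>\<sigma>. \<sigma> permutes {1..n} \<and> Theta n (f \<circ> \<sigma>) = consequences n (AA n))"
    then obtain \<sigma> where "separating n f" and \<sigma>: "\<sigma> permutes {1..n}" "Theta n (f \<circ> \<sigma>) = consequences n (AA n)"
      by blast
    then have "separating n (f \<circ> \<sigma>)"
      using separating_permute by blast
    then have "pseudo_triangular_basis n (f \<circ> \<sigma>)"
      using cont [OF \<sigma>(1)] range [OF \<sigma>(1)] by (rule Theta_basis [OF assms(1) \<sigma>(2)])
    then show "pseudo_triangular_basis n f"
      by (rule pseudo_triangular_basis_permute [OF \<sigma>(1)])
  next
    assume "ordered_pseudo_triangular_basis n f"
    then show "Theta n f = consequences n (AA n)"
      using range [OF permutes_id] assms(1) by (intro ordered_basis_Theta(1)) auto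
  }
qed

end
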